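(* Let $(\xi_n)_{n=0}^\infty$ be a nonhomogeneous Markov chain on a probability space $(\Omega,\mathcal{F},\mathbb{P})$ with values in the finite state space $\mathbf{X}=\{1,2,\ldots,b\}$, with initial distribution $(\mu_0(1),\ldots,\mu_0(b))$ and transition matrices $P_n=(p_n(i,j))_{b\times b}$, $n\ge 1$, where $p_n(i,j)=\mathbb{P}(\xi_n=j\mid \xi_{n-1}=i)$. Let $(a_n)_{n=0}^\infty$ and $(\phi(n))_{n=0}^\infty$ be two sequences of nonnegative integers such that $\phi(n)\to\infty$ as $n\to\infty$, and suppose that for every $\varepsilon>0$ $$\sum_{n=1}^\infty \exp[-\varepsilon\phi(n)]<\infty .$$ Let $P=(p(i,j))_{b\times b}$ be an irreducible transition matrix on $\mathbf{X}$, and suppose that $$\lim_{n\to\infty}\frac{1}{\phi(n)}\sum_{k=a_n+1}^{a_n+\phi(n)}|p_k(i,j)-p(i,j)|=0\qquad\text{for all } i,j\in\mathbf{X}.$$ Let $(\pi_1,\ldots,\pi_b)$ be the unique stationary distribution determined by $P$. Then, with $S_{a_n,\phi(n)}(i;\omega)$, $S_{a_n,\phi(n)}(i,j;\omega)$ and $f_{a_n,\phi(n)}(\omega)$ as defined in the context, for all $i,j\in\mathbf{X}$ the sequences $\frac{1}{\phi(n)}S_{a_n,\phi(n)}(i;\omega)$, $\frac{1}{\phi(n)}S_{a_n,\phi(n)}(i,j;\omega)$ and $f_{a_n,\phi(n)}(\omega)$ are each uniformly integrable (in $n$), and the following limits hold in $\mathcal{L}_1(\mathbb{P})$ as $n\to\infty$: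 (i) $\displaystyle \frac{1}{\phi(n)}S_{a_n,\phi(n)}(i;\omega)\to\pi_i$ for all $i\in\mathbf{X}$; (ii) $\displaystyle \frac{1}{\phi(n)}S_{a_n,\phi(n)}(i,j;\omega)\to\pi_i\,p(i,j)$ for all $i,j\in\mathbf{X}$; (iii) $\displaystyle f_{a_n,\phi(n)}(\omega)\to-\sum_{i=1}^b\sum_{j=1}^b\pi_i\,p(i,j)\log p(i,j)$.
   Context: $\log$ is the natural logarithm, with the usual convention $0\log 0=0$. $\mathbf{1}_{\{i\}}(\cdot)$ is the indicator function of $\{i\}$. The ratios with denominator $\phi(n)$ are considered for those $n$ with $\phi(n)\ge 1$ (all sufficiently large $n$). For nonnegative integers $m,n$ and $i,j\in\mathbf{X}$, $$S_{m,n}(j;\omega)=\sum_{k=m}^{m+n-1}\mathbf{1}_{\{j\}}(\xi_k)$$ is the number of occurrences of $j$ in the segment $\xi_m,\ldots,\xi_{m+n-1}$, and $$S_{m,n}(i,j;\omega)=\sum_{k=m}^{m+n-1}\mathbf{1}_{\{i\}}(\xi_k)\mathbf{1}_{\{j\}}(\xi_{k+1})$$ is the number of occurrences of the pair $(i,j)$ among $(\xi_m,\xi_{m+1}),\ldots,(\xi_{m+n-1},\xi_{m+n})$. The generalized entropy density of $(\xi_{a_n},\ldots,\xi_{a_n+\phi(n)})$ for the Markov chain is $$f_{a_n,\phi(n)}(\omega)=-\frac{1}{\phi(n)}\Big\{\log\mu_{a_n}(\xi_{a_n})+\sum_{k=a_n+1}^{a_n+\phi(n)}\log p_k(\xi_{k-1},\xi_k)\Big\},$$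 where $\mu_{a_n}(x)=\mathbb{P}(\xi_{a_n}=x)$ is the distribution of $\xi_{a_n}$. *)

theory Defs
  imports "HOL-Probability.Probability"
begin

definition transition_matrix :: "nat \<Rightarrow> (nat \<Rightarrow> nat \<Rightarrow> real) \<Rightarrow> bool" where
  "transition_matrix b Q \<longleftrightarrow>
     (\<forall>i\<in>{1..b}. \<forall>j\<in>{1..b}. 0 \<le> Q i j) \<and> (\<forall>i\<in>{1..b}. (\<Sum>j=1..b. Q i j) = 1)"

primrec matrix_power :: "nat \<Rightarrow> (nat \<Rightarrow> nat \<Rightarrow> real) \<Rightarrow> nat \<Rightarrow> nat \<Rightarrow> nat \<Rightarrow> real" where
  "matrix_power b Q 0 i j = (if i = j then 1 else 0)"
| "matrix_power b Q (Suc n) i j = (\<Sum>k=1..b. matrix_power b Q n i k * Q k j)"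

definition irreducible_transition_matrix :: "nat \<Rightarrow> (nat \<Rightarrow> nat \<Rightarrow> real) \<Rightarrow> bool" where
  "irreducible_transition_matrix b Q \<longleftrightarrow>
     transition_matrix b Q \<and>
     (\<forall>i\<in>{1..b}. \<forall>j\<in>{1..b}. \<exists>n\<ge>1. matrix_power b Q n i j > 0)"

definition stationary_distribution ::
    "nat \<Rightarrow> (nat \<Rightarrow> nat \<Rightarrow> real) \<Rightarrow> (nat \<Rightarrow> real) \<Rightarrow> bool" where
  "stationary_distribution b Q \<pi> \<longleftrightarrow>
     (\<forall>i\<in>{1..b}. 0 \<le> \<pi> i) \<and> (\<Sum>i=1..b. \<pi> i) = 1 \<and>
     (\<forall>j\<in>{1..b}. (\<Sum>i=1..b. \<pi> i * Q i j) = \<pi> j)"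

definition state_distribution :: "'w measure \<Rightarrow> (nat \<Rightarrow> 'w \<Rightarrow> nat) \<Rightarrow> nat \<Rightarrow> nat \<Rightarrow> real" where
  "state_distribution M \<xi> n x = \<P>(\<omega> in M. \<xi> n \<omega> = x)"

text \<open>Conditional probabilities are only constrained when the conditioning event has positive
  probability; the remaining rows of \<open>p n\<close> are arbitrary probability vectors.\<close>

locale nonhomogeneous_markov_chain = prob_space M
  for M :: "'w measure" +
  fixes b :: nat
    and \<xi> :: "nat \<Rightarrow> 'w \<Rightarrow> nat"
    and \<mu>0 :: "nat \<Rightarrow> real"
    and p :: "nat \<Rightarrow> nat \<Rightarrow> nat \<Rightarrow> real"
  assumes state_measurable: "\<And>n. \<xi> n \<in> measurable M (count_space {1..b})"
    and initial: "\<And>i. i \<in> {1..b} \<Longrightarrow> \<P>(\<omega> in M. \<xi> 0 \<omega> = i) = \<mu>0 i"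
    and stochastic: "\<And>n. n \<ge> 1 \<Longrightarrow> transition_matrix b (p n)"
    and transition: "\<And>n i j. \<lbrakk>n \<ge> 1; i \<in> {1..b}; j \<in> {1..b}; \<P>(\<omega> in M. \<xi> (n - 1) \<omega> = i) > 0\<rbrakk>
        \<Longrightarrow> \<P>(\<omega> in M. \<xi> n \<omega> = j \<bar> \<xi> (n - 1) \<omega> = i) = p n i j"
    and markov: "\<And>n x. \<lbrakk>n \<ge> 1; \<forall>k\<le>n. x k \<in> {1..b}; \<P>(\<omega> in M. \<forall>k<n. \<xi> k \<omega> = x k) > 0\<rbrakk>
        \<Longrightarrow> \<P>(\<omega> in M. \<xi> n \<omega> = x n \<bar> \<forall>k<n. \<xi> k \<omega> = x k) =
            \<P>(\<omega> in M. \<xi> n \<omega> = x n \<bar> \<xi> (n - 1) \<omega> = x (n - 1))"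

definition state_count :: "(nat \<Rightarrow> 'w \<Rightarrow> nat) \<Rightarrow> nat \<Rightarrow> nat \<Rightarrow> nat \<Rightarrow> 'w \<Rightarrow> real" where
  "state_count \<xi> m n j \<omega> = (\<Sum>k\<in>{m..<m + n}. indicator {j} (\<xi> k \<omega>))"

definition pair_count :: "(nat \<Rightarrow> 'w \<Rightarrow> nat) \<Rightarrow> nat \<Rightarrow> nat \<Rightarrow> nat \<Rightarrow> nat \<Rightarrow> 'w \<Rightarrow> real" where
  "pair_count \<xi> m n i j \<omega> =
     (\<Sum>k\<in>{m..<m + n}. indicator {i} (\<xi> k \<omega>) * indicator {j} (\<xi> (k + 1) \<omega>))"

text \<open>The logarithms are taken at almost surely positive arguments, so the library value
  \<open>ln 0 = 0\<close> only matters on a null set.\<close>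

definition generalized_entropy_density ::
    "'w measure \<Rightarrow> (nat \<Rightarrow> 'w \<Rightarrow> nat) \<Rightarrow> (nat \<Rightarrow> nat \<Rightarrow> nat \<Rightarrow> real) \<Rightarrow> nat \<Rightarrow> nat \<Rightarrow> 'w \<Rightarrow> real" where
  "generalized_entropy_density M \<xi> p m n \<omega> =
     - (1 / real n) * (ln (state_distribution M \<xi> m (\<xi> m \<omega>)) +
        (\<Sum>k=m+1..m+n. ln (p k (\<xi> (k - 1) \<omega>) (\<xi> k \<omega>))))"

definition uniformly_integrable :: "'w measure \<Rightarrow> 'i set \<Rightarrow> ('i \<Rightarrow> 'w \<Rightarrow> real) \<Rightarrow> bool" where
  "uniformly_integrable M I X \<longleftrightarrow>
     (\<forall>n\<in>I. integrable M (X n)) \<and>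
     ((\<lambda>K::real. SUP n\<in>I. \<integral>\<^sup>+\<omega>. ennreal \<bar>X n \<omega>\<bar> * indicator {\<omega>. \<bar>X n \<omega>\<bar> > K} \<omega> \<partial>M) \<longlongrightarrow> 0) at_top"

definition tendsto_L1 :: "'w measure \<Rightarrow> (nat \<Rightarrow> 'w \<Rightarrow> real) \<Rightarrow> ('w \<Rightarrow> real) \<Rightarrow> bool" where
  "tendsto_L1 M X Y \<longleftrightarrow>
     (\<forall>\<^sub>F n in sequentially. integrable M (X n)) \<and> integrable M Y \<and>
     (\<lambda>n. \<integral>\<omega>. \<bar>X n \<omega> - Y \<omega>\<bar> \<partial>M) \<longlonglongrightarrow> 0"

end

theory Submission
  imports Defs "HOL-Library.Landau_Symbols"
begin

text \<open>
  Centering a function of the transitions \<open>(\<xi>\<^sub>k\<^sub>-\<^sub>1, \<xi>\<^sub>k)\<close> by its conditional mean given the past yields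
  orthogonal increments, so over a window of length \<open>N\<close> their sum has \<open>L\<^sub>1\<close> norm \<open>O(\<surd>N)\<close>, whatever the
  position of the window. For the indicator of a pair \<open>(i, j)\<close> this shows that the normalized pair
  count is close to \<open>x\<^sub>i P\<^sub>i\<^sub>j\<close>, where \<open>x\<close> is the vector of normalized state counts. Summing over
  \<open>i\<close> shows that \<open>x\<close> is almost invariant under \<open>P\<close>, and by Doeblin's argument an almost invariant
  probability vector is close to \<open>\<pi>\<close>. For \<open>ln p\<^sub>k\<close> the conditional second moments are bounded since
  \<open>x (ln x)\<^sup>2 \<le> 4\<close> on \<open>[0, 1]\<close>, and the conditional means are averages of the uniformly continuous
  function \<open>x ln x\<close>. The same second moment bound gives uniform integrability.
\<close>

section \<open>Stability of the stationary distribution\<close>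

text \<open>The triangle inequality moves the absolute values onto \<open>v\<close>, and exchanging
  the sums leaves the row sums. A general \<open>s\<close> serves both \<open>P\<close> itself,
  where it is 1, and the matrix with lowered row sums in Doeblin's argument.\<close>

lemma L1_contraction:
  assumes "\<And>i j. i \<in> I \<Longrightarrow> j \<in> I \<Longrightarrow> 0 \<le> Q i j"
    and "\<And>i. i \<in> I \<Longrightarrow> (\<Sum>j\<in>I. Q i j) = (s::real)"
  shows "(\<Sum>j\<in>I. \<bar>\<Sum>i\<in>I. v i * Q i j\<bar>) \<le> s * (\<Sum>i\<in>I. \<bar>v i\<bar>)"
proof -
  have "(\<Sum>j\<in>I. \<bar>\<Sum>i\<in>I. v i * Q i j\<bar>) \<le> (\<Sum>j\<in>I. \<Sum>i\<in>I. \<bar>v i\<bar> * Q i j)"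
    using assms(1) by (intro sum_mono order_trans[OF sum_abs] ) (simp add: abs_mult)
  also have "\<dots> = (\<Sum>i\<in>I. \<bar>v i\<bar> * (\<Sum>j\<in>I. Q i j))"
    by (subst sum.swap) (simp add: sum_distrib_left)
  also have "\<dots> = s * (\<Sum>i\<in>I. \<bar>v i\<bar>)"
    by (simp add: assms(2) sum_distrib_left mult.commute)
  finally show ?thesis .
qed

lemma transition_matrix_entry:
  assumes "transition_matrix b Q" "i \<in> {1..b}" "j \<in> {1..b}"
  shows "0 \<le> Q i j" "Q i j \<le> 1"
proof -
  show "0 \<le> Q i j"
    using assms by (simp add: transition_matrix_def)
  have "Q i j \<le> (\<Sum>j=1..b. Q i j)"
    using assms unfolding transition_matrix_def by (intro member_le_sum) auto
  then show "Q i j \<le> 1"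
    using assms by (simp add: transition_matrix_def)
qed

lemma transition_matrix_power:
  assumes "transition_matrix b Q"
  shows "transition_matrix b (matrix_power b Q n)"
proof (induction n)
  case 0
  show ?case by (auto simp: transition_matrix_def)
next
  case (Suc n)
  have "(\<Sum>j=1..b. \<Sum>k=1..b. matrix_power b Q n i k * Q k j) = 1" if i: "i \<in> {1..b}" for i
  proof -
    have "(\<Sum>j=1..b. \<Sum>k=1..b. matrix_power b Q n i k * Q k j)
        = (\<Sum>k=1..b. matrix_power b Q n i k * (\<Sum>j=1..b. Q k j))"
      by (subst sum.swap) (simp add: sum_distrib_left)
    also have "\<dots> = 1"
      using assms Suc i by (simp add: transition_matrix_def)
    finally show ?thesis .
  qed
  then show ?case
    using assms Suc unfolding transition_matrix_def
    by (auto intro!: sum_nonneg mult_nonneg_nonneg)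
qed

text \<open>Since v - v P^(t+1) = (v - v P) + (v - v P^t) P and \<open>P\<close> contracts the L1
  norm, every further step costs at most one more one-step defect.\<close>

lemma L1_defect_matrix_power:
  assumes "transition_matrix b P"
  shows "(\<Sum>j=1..b. \<bar>v j - (\<Sum>i=1..b. v i * matrix_power b P t i j)\<bar>)
    \<le> real t * (\<Sum>j=1..b. \<bar>v j - (\<Sum>i=1..b. v i * P i j)\<bar>)"
proof (induction t)
  case 0
  have "(\<Sum>i=1..b. v i * matrix_power b P 0 i j) = v j" if "j \<in> {1..b}" for j
    using that by (simp add: if_distrib[of "\<lambda>x. _ * x"] sum.delta cong: if_cong)
  then show ?case by simp
next
  case (Suc t)
  define w where "w j = (\<Sum>i=1..b. v i * matrix_power b P t i j)" for j
  let ?d = "\<Sum>j=1..b. \<bar>v j - (\<Sum>i=1..b. v i * P i j)\<bar>"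
  have "(\<Sum>i=1..b. v i * matrix_power b P (Suc t) i j) = (\<Sum>k=1..b. w k * P k j)" for j
    unfolding w_def matrix_power.simps sum_distrib_left sum_distrib_right
    by (subst sum.swap) (simp add: mult.assoc)
  then have "(\<Sum>j=1..b. \<bar>v j - (\<Sum>i=1..b. v i * matrix_power b P (Suc t) i j)\<bar>)
     = (\<Sum>j=1..b. \<bar>(v j - (\<Sum>i=1..b. v i * P i j)) + (\<Sum>i=1..b. (v i - w i) * P i j)\<bar>)"
    by (simp add: left_diff_distrib sum_subtractf)
  also have "\<dots> \<le> (\<Sum>j=1..b. \<bar>v j - (\<Sum>i=1..b. v i * P i j)\<bar> + \<bar>\<Sum>i=1..b. (v i - w i) * P i j\<bar>)"
    by (intro sum_mono abs_triangle_ineq)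
  also have "\<dots> = ?d + (\<Sum>j=1..b. \<bar>\<Sum>i=1..b. (v i - w i) * P i j\<bar>)"
    by (simp add: sum.distrib)
  also have "\<dots> \<le> ?d + 1 * (\<Sum>j=1..b. \<bar>v j - w j\<bar>)"
    using assms by (intro add_left_mono L1_contraction) (auto simp: transition_matrix_def)
  also have "\<dots> \<le> ?d + real t * ?d"
    using Suc by (simp add: w_def)
  finally show ?case by (simp add: algebra_simps)
qed

text \<open>Doeblin's argument: the sum \<open>R\<close> of one power of \<open>P\<close> for each pair of states that makes the
  corresponding entry positive has all entries at least some \<open>c > 0\<close>; subtracting \<open>c\<close> from every
  entry does not change \<open>v R\<close> when \<open>v\<close> sums to zero, but lowers the row sums.\<close>

lemma irreducible_L1_stability:
  assumes irr: "irreducible_transition_matrix b P"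
  obtains C :: real where "0 \<le> C"
    and "\<And>v. (\<Sum>i=1..b. v i) = 0 \<Longrightarrow>
      (\<Sum>i=1..b. \<bar>v i\<bar>) \<le> C * (\<Sum>j=1..b. \<bar>v j - (\<Sum>i=1..b. v i * P i j)\<bar>)"
proof (cases "b = 0")
  case True
  then show ?thesis using that[of 0] by simp
next
  case False
  define I where "I = {1..b}"
  have I: "finite I" "I \<noteq> {}" "card I = b" using False by (auto simp: I_def)
  have tm: "transition_matrix b P" using irr by (simp add: irreducible_transition_matrix_def)
  have "\<forall>s\<in>I \<times> I. \<exists>n. matrix_power b P n (fst s) (snd s) > 0"
    using irr unfolding irreducible_transition_matrix_def I_def by fastforce
  from bchoice[OF this] obtain N where "\<forall>s\<in>I \<times> I. matrix_power b P (N s) (fst s) (snd s) > 0"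
    by auto
  then have N: "\<And>i j. i \<in> I \<Longrightarrow> j \<in> I \<Longrightarrow> matrix_power b P (N (i, j)) i j > 0"
    by auto
  have pw: "0 \<le> matrix_power b P n i j" "(\<Sum>j\<in>I. matrix_power b P n i j) = 1"
    if "i \<in> I" "j \<in> I" for n i j
    using transition_matrix_power[OF tm, of n] that by (auto simp: transition_matrix_def I_def)
  define R where "R i j = (\<Sum>s\<in>I \<times> I. matrix_power b P (N s) i j)" for i j
  have R_pos: "R i j > 0" if "i \<in> I" "j \<in> I" for i j
    unfolding R_def
    by (rule sum_pos2[of _ "(i, j)"]) (use that N pw I in auto)
  \<comment> \<open>\<open>R\<close> is a sum of \<open>b ^ 2\<close> stochastic matrices, one for
    each pair of states.\<close>
  have R_sum: "(\<Sum>j\<in>I. R i j) = real b ^ 2" if "i \<in> I" for i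
    unfolding R_def by (subst sum.swap) (use that pw I in \<open>simp add: power2_eq_square\<close>)
  define c where "c = Min ((\<lambda>(i, j). R i j) ` (I \<times> I))"
  have c_le: "c \<le> R i j" if "i \<in> I" "j \<in> I" for i j
    unfolding c_def using that I by (intro Min_le) auto
  have c_pos: "c > 0"
    unfolding c_def using I R_pos by (subst Min_gr_iff) auto
  \<comment> \<open>Each power in \<open>R\<close> moves \<open>v\<close> by at most its exponent
    times the one-step defect; \<open>K\<close> is the total of these exponents.\<close>
  define K where "K = (\<Sum>s\<in>I \<times> I. real (N s))"
  have K: "K \<ge> 0" unfolding K_def by (intro sum_nonneg) auto
  have bc: "real b * c > 0" using c_pos False by simp
  show ?thesis
  proof (rule that[of "K / (real b * c)"])
    show "0 \<le> K / (real b * c)" using K bc by simp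
  next
    fix v :: "nat \<Rightarrow> real"
    assume v0: "(\<Sum>i=1..b. v i) = 0"
    let ?d = "\<Sum>j=1..b. \<bar>v j - (\<Sum>i=1..b. v i * P i j)\<bar>"
    let ?V = "\<Sum>i\<in>I. \<bar>v i\<bar>"
    have "(\<Sum>i\<in>I. v i * (R i j - c)) = (\<Sum>i\<in>I. v i * R i j)" for j
      using v0 by (simp add: right_diff_distrib sum_subtractf I_def flip: sum_distrib_right)
    moreover have "(\<Sum>j\<in>I. \<bar>\<Sum>i\<in>I. v i * (R i j - c)\<bar>) \<le> (real b ^ 2 - real b * c) * ?V"
      using c_le R_sum I by (intro L1_contraction) (auto simp: sum_subtractf)
    ultimately have A: "(\<Sum>j\<in>I. \<bar>\<Sum>i\<in>I. v i * R i j\<bar>) \<le> (real b ^ 2 - real b * c) * ?V"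
      by simp
    have eq: "real b ^ 2 * v j - (\<Sum>i\<in>I. v i * R i j)
       = (\<Sum>s\<in>I \<times> I. v j - (\<Sum>i\<in>I. v i * matrix_power b P (N s) i j))" for j
    proof -
      have "(\<Sum>i\<in>I. v i * R i j) = (\<Sum>s\<in>I \<times> I. \<Sum>i\<in>I. v i * matrix_power b P (N s) i j)"
        unfolding R_def sum_distrib_left by (rule sum.swap)
      then show ?thesis using I by (simp add: sum_subtractf power2_eq_square)
    qed
    have "(\<Sum>j\<in>I. \<bar>real b ^ 2 * v j - (\<Sum>i\<in>I. v i * R i j)\<bar>)
      \<le> (\<Sum>j\<in>I. \<Sum>s\<in>I \<times> I. \<bar>v j - (\<Sum>i\<in>I. v i * matrix_power b P (N s) i j)\<bar>)"
      unfolding eq by (intro sum_mono sum_abs)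
    also have "\<dots> = (\<Sum>s\<in>I \<times> I. \<Sum>j\<in>I. \<bar>v j - (\<Sum>i\<in>I. v i * matrix_power b P (N s) i j)\<bar>)"
      by (rule sum.swap)
    also have "\<dots> \<le> (\<Sum>s\<in>I \<times> I. real (N s) * ?d)"
      using L1_defect_matrix_power[OF tm] by (intro sum_mono) (simp add: I_def)
    also have "\<dots> = K * ?d" by (simp add: K_def sum_distrib_right)
    finally have B: "(\<Sum>j\<in>I. \<bar>real b ^ 2 * v j - (\<Sum>i\<in>I. v i * R i j)\<bar>) \<le> K * ?d" .
    \<comment> \<open>The multiple \<open>b ^ 2\<close> of the norm occurs on both sides and
      cancels; the gap \<open>b * c\<close> in the row sums survives and becomes the denominator of
      the constant.\<close>
    have "real b ^ 2 * ?V = (\<Sum>j\<in>I. \<bar>real b ^ 2 * v j\<bar>)"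
      by (simp add: sum_distrib_left abs_mult)
    also have "\<dots> \<le> (\<Sum>j\<in>I. \<bar>real b ^ 2 * v j - (\<Sum>i\<in>I. v i * R i j)\<bar> + \<bar>\<Sum>i\<in>I. v i * R i j\<bar>)"
      by (intro sum_mono) linarith
    also have "\<dots> \<le> K * ?d + (real b ^ 2 - real b * c) * ?V"
      using A B by (simp add: sum.distrib)
    finally have "real b * c * ?V \<le> K * ?d" by (simp add: algebra_simps)
    then show "(\<Sum>i=1..b. \<bar>v i\<bar>) \<le> K / (real b * c) * ?d"
      using bc by (simp add: I_def field_simps)
  qed
qed

section \<open>Conditioning on the history of the chain\<close>

text \<open>Any function of a finitely valued variable is a finite combination of indicators. Hence
  integrability is automatic for all the logarithmic terms, however small the probabilities inside
  them.\<close>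

lemma (in prob_space) finite_valued:
  fixes h :: "'b \<Rightarrow> real"
  assumes "finite A" and X: "X \<in> measurable M (count_space A)"
  shows integrable_finite_valued: "integrable M (\<lambda>\<omega>. h (X \<omega>))"
    and expectation_finite_valued:
      "expectation (\<lambda>\<omega>. h (X \<omega>)) = (\<Sum>x\<in>A. prob {\<omega> \<in> space M. X \<omega> = x} * h x)"
proof -
  have m: "{\<omega> \<in> space M. X \<omega> = x} \<in> events" for x
    using X by measurable
  have eq: "h (X \<omega>) = (\<Sum>x\<in>A. indicator {\<omega> \<in> space M. X \<omega> = x} \<omega> * h x)" if "\<omega> \<in> space M" for \<omega>
  proof -
    have "X \<omega> \<in> A" using measurable_space[OF X that] by simp
    then show ?thesis using that \<open>finite A\<close> by (simp add: indicator_def if_distrib[of "\<lambda>x. x * _"] cong: if_cong)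
  qed
  have i: "integrable M (\<lambda>\<omega>. \<Sum>x\<in>A. indicator {\<omega> \<in> space M. X \<omega> = x} \<omega> * h x)"
    using m by (intro Bochner_Integration.integrable_sum integrable_mult_left) (simp add: emeasure_eq_measure)
  show "integrable M (\<lambda>\<omega>. h (X \<omega>))"
    using i by (subst Bochner_Integration.integrable_cong[OF refl eq]) auto
  have "expectation (\<lambda>\<omega>. h (X \<omega>)) = expectation (\<lambda>\<omega>. \<Sum>x\<in>A. indicator {\<omega> \<in> space M. X \<omega> = x} \<omega> * h x)"
    using eq by (intro Bochner_Integration.integral_cong) auto
  also have "\<dots> = (\<Sum>x\<in>A. prob {\<omega> \<in> space M. X \<omega> = x} * h x)"
    using m by (subst Bochner_Integration.integral_sum) (auto simp: emeasure_eq_measure)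
  finally show "expectation (\<lambda>\<omega>. h (X \<omega>)) = (\<Sum>x\<in>A. prob {\<omega> \<in> space M. X \<omega> = x} * h x)" .
qed

text \<open>This is the one-step estimate behind orthogonality: \<open>h\<close> stands for the sum
  so far, the cross term vanishes because \<open>f\<close> is centered, and the variance is at most
  the second moment.\<close>

lemma shifted_variance_le:
  fixes q f :: "'i \<Rightarrow> real"
  assumes "(\<Sum>j\<in>J. q j) = 1"
  shows "(\<Sum>j\<in>J. q j * (h + (f j - (\<Sum>j\<in>J. q j * f j)))\<^sup>2) \<le> h\<^sup>2 + (\<Sum>j\<in>J. q j * (f j)\<^sup>2)"
proof -
  define c where "c = (\<Sum>j\<in>J. q j * f j)"
  have "(\<Sum>j\<in>J. q j * (h + (f j - c))\<^sup>2) =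
      (\<Sum>j\<in>J. q j * (h - c)\<^sup>2 + 2 * (h - c) * (q j * f j) + q j * (f j)\<^sup>2)"
    by (intro sum.cong refl) (simp add: power2_eq_square algebra_simps)
  also have "\<dots> = (h - c)\<^sup>2 + 2 * (h - c) * c + (\<Sum>j\<in>J. q j * (f j)\<^sup>2)"
    by (simp add: sum.distrib c_def assms flip: sum_distrib_left sum_distrib_right)
  also have "\<dots> = h\<^sup>2 - c\<^sup>2 + (\<Sum>j\<in>J. q j * (f j)\<^sup>2)"
    by (simp add: power2_eq_square algebra_simps)
  finally show ?thesis unfolding c_def by simp
qed

context nonhomogeneous_markov_chain
begin

text \<open>Restricting to indices below \<open>l\<close> gives the past values in the finite set
  \<open>histories l\<close>, so conditioning on it reduces to finite sums. The state at time
  \<open>l\<close> itself is not included.\<close>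

definition history :: "nat \<Rightarrow> 'w \<Rightarrow> nat \<Rightarrow> nat" where
  "history l \<omega> = (\<lambda>k\<in>{..<l}. \<xi> k \<omega>)"

abbreviation histories :: "nat \<Rightarrow> (nat \<Rightarrow> nat) set" where
  "histories l \<equiv> PiE {..<l} (\<lambda>_. {1..b})"

lemma state_in: "\<omega> \<in> space M \<Longrightarrow> \<xi> n \<omega> \<in> {1..b}"
  using measurable_space[OF state_measurable] by simp

lemma history_apply [simp]: "k < l \<Longrightarrow> history l \<omega> k = \<xi> k \<omega>"
  by (simp add: history_def)

lemma history_eq_iff: "x \<in> histories l \<Longrightarrow> history l \<omega> = x \<longleftrightarrow> (\<forall>k<l. \<xi> k \<omega> = x k)"
  unfolding history_def by (auto simp: fun_eq_iff PiE_def extensional_def restrict_def)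

lemma state_event [measurable]: "{\<omega> \<in> space M. \<xi> k \<omega> = i} \<in> events"
  using state_measurable[of k] by measurable

lemma finite_histories: "finite (histories l)"
  by (intro finite_PiE) auto

lemma history_measurable: "history l \<in> measurable M (count_space (histories l))"
proof -
  have "history l -` {x} \<inter> space M = {\<omega> \<in> space M. \<forall>k\<in>{..<l}. \<xi> k \<omega> = x k}" if "x \<in> histories l" for x
    using history_eq_iff[OF that] by auto
  then have "history l -` {x} \<inter> space M \<in> events" if "x \<in> histories l" for x
    using that by (auto intro!: sets.sets_Collect_finite_All')
  then show ?thesis
    using state_in by (subst measurable_count_space_eq2[OF finite_histories]) (auto simp: history_def)
qed

lemma history_step_measurable:
  "(\<lambda>\<omega>. (history l \<omega>, \<xi> l \<omega>)) \<in> measurable M (count_space (histories l \<times> {1..b}))"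
proof -
  have "(\<lambda>\<omega>. (history l \<omega>, \<xi> l \<omega>)) \<in> measurable M (count_space (histories l) \<Otimes>\<^sub>M count_space {1..b})"
    using history_measurable state_measurable by (rule measurable_Pair)
  then show ?thesis
    by (simp only: pair_measure_count_space finite_histories finite_atLeastAtMost)
qed

lemma integrable_history: "integrable M (\<lambda>\<omega>. h (history l \<omega>) :: real)"
  by (rule integrable_finite_valued[OF finite_histories history_measurable])

lemma integrable_history_step: "integrable M (\<lambda>\<omega>. G (history l \<omega>) (\<xi> l \<omega>) :: real)"
  using integrable_finite_valued[OF _ history_step_measurable[of l], where h = "case_prod G"] finite_histories
  by simp

text \<open>The Markov property reduces conditioning on the whole past to conditioning on the last
  state, where \<open>transition\<close> applies. If the past has probability zero, both sides
  vanish, which covers the rows of \<open>p l\<close> that the chain does not determine.\<close>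

lemma prob_history_step:
  assumes l: "l \<ge> 1" and x: "x \<in> histories l" and j: "j \<in> {1..b}"
  shows "prob {\<omega> \<in> space M. history l \<omega> = x \<and> \<xi> l \<omega> = j} =
    prob {\<omega> \<in> space M. history l \<omega> = x} * p l (x (l - 1)) j"
proof -
  define A where "A = {\<omega> \<in> space M. history l \<omega> = x}"
  \<comment> \<open>\<open>markov\<close> speaks of a single path that includes the new time, so the
    past \<open>x\<close> is continued by \<open>j\<close>.\<close>
  define y where "y = x(l := j)"
  have A: "A = {\<omega> \<in> space M. \<forall>k<l. \<xi> k \<omega> = y k}"
    using history_eq_iff[OF x] by (auto simp: A_def y_def)
  have A_event: "A \<in> events"
    using history_measurable[of l] unfolding A_def by measurable
  show ?thesis
  proof (cases "prob A = 0")
    case True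
    have "prob {\<omega> \<in> space M. history l \<omega> = x \<and> \<xi> l \<omega> = j} \<le> prob A"
      using A_event by (intro finite_measure_mono) (auto simp: A_def)
    then have "prob {\<omega> \<in> space M. history l \<omega> = x \<and> \<xi> l \<omega> = j} = 0"
      using True by (simp add: measure_le_0_iff)
    then show ?thesis using True by (simp add: A_def)
  next
    case False
    then have pos: "prob A > 0" by (simp add: zero_less_measure_iff)
    have yl: "y (l - 1) = x (l - 1)" "y l = j" using l by (auto simp: y_def)
    have xl: "x (l - 1) \<in> {1..b}" using l x by (auto simp: PiE_def Pi_def)
    \<comment> \<open>The last state inherits positive probability from the history, as
      \<open>transition\<close> requires.\<close>
    have "prob A \<le> prob {\<omega> \<in> space M. \<xi> (l - 1) \<omega> = x (l - 1)}"
      using l by (intro finite_measure_mono) (auto simp: A_def)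
    then have pos': "prob {\<omega> \<in> space M. \<xi> (l - 1) \<omega> = x (l - 1)} > 0"
      using pos by linarith
    have "cond_prob M (\<lambda>\<omega>. \<xi> l \<omega> = y l) (\<lambda>\<omega>. \<forall>k<l. \<xi> k \<omega> = y k) = p l (x (l - 1)) j"
      using markov[of l y] transition[OF l xl j pos'] pos x j l
      by (simp add: A yl) (auto simp: y_def PiE_def Pi_def)
    then have "prob {\<omega> \<in> space M. \<xi> l \<omega> = j \<and> (\<forall>k<l. \<xi> k \<omega> = y k)} / prob A = p l (x (l - 1)) j"
      by (simp add: cond_prob_def A yl)
    moreover have "{\<omega> \<in> space M. \<xi> l \<omega> = j \<and> (\<forall>k<l. \<xi> k \<omega> = y k)} =
        {\<omega> \<in> space M. history l \<omega> = x \<and> \<xi> l \<omega> = j}"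
      using A by (auto simp: A_def)
    ultimately show ?thesis
      using pos by (simp add: field_simps A_def)
  qed
qed

text \<open>The tower property: given the history, the new state is averaged with the row of
  \<open>p l\<close> at the last state while the history stays frozen.\<close>

lemma expectation_step:
  fixes G :: "(nat \<Rightarrow> nat) \<Rightarrow> nat \<Rightarrow> real"
  assumes l: "l \<ge> 1"
  shows "expectation (\<lambda>\<omega>. G (history l \<omega>) (\<xi> l \<omega>)) =
    expectation (\<lambda>\<omega>. \<Sum>j=1..b. p l (\<xi> (l - 1) \<omega>) j * G (history l \<omega>) j)"
proof -
  have "expectation (\<lambda>\<omega>. G (history l \<omega>) (\<xi> l \<omega>)) =
      (\<Sum>(x, j)\<in>histories l \<times> {1..b}. prob {\<omega> \<in> space M. history l \<omega> = x \<and> \<xi> l \<omega> = j} * G x j)"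
    using expectation_finite_valued[OF _ history_step_measurable[of l], where h = "case_prod G"] finite_histories
    by (simp add: case_prod_unfold prod_eq_iff)
  also have "\<dots> = (\<Sum>x\<in>histories l. \<Sum>j=1..b. prob {\<omega> \<in> space M. history l \<omega> = x \<and> \<xi> l \<omega> = j} * G x j)"
    by (simp add: sum.cartesian_product)
  also have "\<dots> = (\<Sum>x\<in>histories l. prob {\<omega> \<in> space M. history l \<omega> = x} * (\<Sum>j=1..b. p l (x (l - 1)) j * G x j))"
    using prob_history_step[OF l] by (intro sum.cong refl) (simp add: sum_distrib_left mult.assoc)
  also have "\<dots> = expectation (\<lambda>\<omega>. \<Sum>j=1..b. p l (history l \<omega> (l - 1)) j * G (history l \<omega>) j)"
    by (rule expectation_finite_valued[OF finite_histories history_measurable,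
          of "\<lambda>x. \<Sum>j=1..b. p l (x (l - 1)) j * G x j", symmetric])
  finally show ?thesis using l by simp
qed

section \<open>Moment bounds for functions of the transitions\<close>

lemma integrable_step:
  fixes F :: "nat \<Rightarrow> nat \<Rightarrow> real"
  assumes "k \<ge> 1"
  shows "integrable M (\<lambda>\<omega>. F (\<xi> (k - 1) \<omega>) (\<xi> k \<omega>))"
  using integrable_history_step[of "\<lambda>x. F (x (k - 1))" k] assms by simp

lemma integrable_state: "integrable M (\<lambda>\<omega>. f (\<xi> k \<omega>) :: real)"
  by (rule integrable_finite_valued[OF _ state_measurable]) simp

lemma expectation_step_le:
  assumes k: "k \<ge> 1" and B: "\<And>i. i \<in> {1..b} \<Longrightarrow> (\<Sum>j=1..b. p k i j * F i j) \<le> (B::real)"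
  shows "expectation (\<lambda>\<omega>. F (\<xi> (k - 1) \<omega>) (\<xi> k \<omega>)) \<le> B"
proof -
  have "expectation (\<lambda>\<omega>. F (\<xi> (k - 1) \<omega>) (\<xi> k \<omega>))
      = expectation (\<lambda>\<omega>. \<Sum>j=1..b. p k (\<xi> (k - 1) \<omega>) j * F (\<xi> (k - 1) \<omega>) j)"
    using expectation_step[OF k, of "\<lambda>x. F (x (k - 1))"] k by simp
  also have "\<dots> \<le> expectation (\<lambda>_. B)"
    using integrable_state[of "\<lambda>i. \<Sum>j=1..b. p k i j * F i j" "k - 1"] state_in
    by (intro integral_mono B) auto
  finally show ?thesis by (simp add: prob_space)
qed

text \<open>For \<open>k \<ge> 1\<close> these are martingale differences: the subtracted sum is the
  conditional mean of the first term given the states before time \<open>k\<close>.\<close>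

definition deviation :: "(nat \<Rightarrow> nat \<Rightarrow> nat \<Rightarrow> real) \<Rightarrow> nat \<Rightarrow> 'w \<Rightarrow> real" where
  "deviation F k \<omega> = F k (\<xi> (k - 1) \<omega>) (\<xi> k \<omega>) -
     (\<Sum>j=1..b. p k (\<xi> (k - 1) \<omega>) j * F k (\<xi> (k - 1) \<omega>) j)"

text \<open>The whole window is a function of the finite history up to and including time
  \<open>m + N\<close>, so every power is integrable.\<close>

lemma integrable_deviation_sum_power:
  "integrable M (\<lambda>\<omega>. (\<Sum>k=m+1..m+N. deviation F k \<omega>) ^ e)"
proof -
  have "integrable M (\<lambda>\<omega>. (\<Sum>k=m+1..m+N. F k (history (Suc (m + N)) \<omega> (k - 1)) (history (Suc (m + N)) \<omega> k) -
     (\<Sum>j=1..b. p k (history (Suc (m + N)) \<omega> (k - 1)) j * F k (history (Suc (m + N)) \<omega> (k - 1)) j)) ^ e)"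
    by (rule integrable_history)
  moreover have "(\<Sum>k=m+1..m+N. F k (history (Suc (m + N)) \<omega> (k - 1)) (history (Suc (m + N)) \<omega> k) -
     (\<Sum>j=1..b. p k (history (Suc (m + N)) \<omega> (k - 1)) j * F k (history (Suc (m + N)) \<omega> (k - 1)) j))
     = (\<Sum>k=m+1..m+N. deviation F k \<omega>)" for \<omega>
    by (intro sum.cong refl) (auto simp: deviation_def)
  ultimately show ?thesis by simp
qed

text \<open>By induction on the window length: the newest increment is centered given the earlier
  ones, so it adds at most \<open>B\<close>. The bound is independent of the position
  \<open>m\<close> of the window, which the arbitrary sequence \<open>a\<close> of the theorem
  demands.\<close>

lemma deviation_second_moment:
  assumes B: "\<And>k i. k \<ge> 1 \<Longrightarrow> i \<in> {1..b} \<Longrightarrow> (\<Sum>j=1..b. p k i j * (F k i j)\<^sup>2) \<le> B"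
  shows "expectation (\<lambda>\<omega>. (\<Sum>k=m+1..m+N. deviation F k \<omega>)\<^sup>2) \<le> real N * B"
proof (induction N)
  case 0
  show ?case by simp
next
  case (Suc N)
  define l where "l = Suc (m + N)"
  define D where "D k i j = F k i j - (\<Sum>j=1..b. p k i j * F k i j)" for k i j
  \<comment> \<open>As a function of the history, the sum so far is fixed while the newest term is
    averaged.\<close>
  define H where "H x = (\<Sum>k=m+1..m+N. D k (x (k - 1)) (x k))" for x
  have H: "H (history l \<omega>) = (\<Sum>k=m+1..m+N. deviation F k \<omega>)" for \<omega>
    unfolding H_def by (intro sum.cong refl) (auto simp: deviation_def D_def l_def)
  have l: "l \<ge> 1" by (simp add: l_def)
  have "expectation (\<lambda>\<omega>. (\<Sum>k=m+1..m+Suc N. deviation F k \<omega>)\<^sup>2) =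
      expectation (\<lambda>\<omega>. (H (history l \<omega>) + D l (history l \<omega> (l - 1)) (\<xi> l \<omega>))\<^sup>2)"
    unfolding H using l by (simp add: D_def deviation_def l_def)
  also have "\<dots> = expectation (\<lambda>\<omega>. \<Sum>j=1..b. p l (\<xi> (l - 1) \<omega>) j * (H (history l \<omega>) + D l (\<xi> (l - 1) \<omega>) j)\<^sup>2)"
    using expectation_step[OF l, of "\<lambda>x j. (H x + D l (x (l - 1)) j)\<^sup>2"] l by simp
  also have "\<dots> \<le> expectation (\<lambda>\<omega>. (H (history l \<omega>))\<^sup>2 + B)"
  proof (rule integral_mono)
    show "integrable M (\<lambda>\<omega>. \<Sum>j=1..b. p l (\<xi> (l - 1) \<omega>) j * (H (history l \<omega>) + D l (\<xi> (l - 1) \<omega>) j)\<^sup>2)"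
      using integrable_history[of "\<lambda>x. \<Sum>j=1..b. p l (x (l - 1)) j * (H x + D l (x (l - 1)) j)\<^sup>2" l] l by simp
    show "integrable M (\<lambda>\<omega>. (H (history l \<omega>))\<^sup>2 + B)"
      by (rule integrable_history)
  next
    fix \<omega> assume w: "\<omega> \<in> space M"
    show "(\<Sum>j=1..b. p l (\<xi> (l - 1) \<omega>) j * (H (history l \<omega>) + D l (\<xi> (l - 1) \<omega>) j)\<^sup>2) \<le> (H (history l \<omega>))\<^sup>2 + B"
    proof -
      have "(\<Sum>j=1..b. p l (\<xi> (l - 1) \<omega>) j) = 1"
        using stochastic[OF l] state_in[OF w] unfolding transition_matrix_def by blast
      from shifted_variance_le[OF this, of "H (history l \<omega>)" "F l (\<xi> (l - 1) \<omega>)"]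
      show ?thesis
        using B[OF l state_in[OF w, of "l - 1"]] unfolding D_def by linarith
    qed
  qed
  also have "\<dots> = expectation (\<lambda>\<omega>. (H (history l \<omega>))\<^sup>2) + B"
    using integrable_history[of "\<lambda>x. (H x)\<^sup>2" l] by (simp add: prob_space)
  also have "\<dots> \<le> real (Suc N) * B"
    using Suc unfolding H by (simp add: algebra_simps)
  finally show ?case .
qed

text \<open>The variance of the absolute value is nonnegative, so its squared mean is at most the
  second moment.\<close>

lemma deviation_first_moment:
  assumes "\<And>k i. k \<ge> 1 \<Longrightarrow> i \<in> {1..b} \<Longrightarrow> (\<Sum>j=1..b. p k i j * (F k i j)\<^sup>2) \<le> B"
  shows "expectation (\<lambda>\<omega>. \<bar>\<Sum>k=m+1..m+N. deviation F k \<omega>\<bar>) \<le> sqrt (real N * B)"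
proof -
  let ?X = "\<lambda>\<omega>. \<bar>\<Sum>k=m+1..m+N. deviation F k \<omega>\<bar>"
  have "integrable M ?X" "integrable M (\<lambda>\<omega>. (?X \<omega>)\<^sup>2)"
    using integrable_deviation_sum_power[of F m N 1] integrable_deviation_sum_power[of F m N 2] by auto
  from variance_eq[OF this] have "(expectation ?X)\<^sup>2 \<le> expectation (\<lambda>\<omega>. (?X \<omega>)\<^sup>2)"
    using variance_positive[of ?X] by linarith
  also have "\<dots> \<le> real N * B" using deviation_second_moment[OF assms] by simp
  finally show ?thesis by (rule real_le_rsqrt)
qed

end

section \<open>State and pair counts\<close>

text \<open>The counts index a transition by its earlier time, the matrices \<open>p k\<close> by
  its later time; this passes from one convention to the other.\<close>

lemma sum_shift_step:
  fixes g :: "nat \<Rightarrow> nat \<Rightarrow> real"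
  shows "(\<Sum>k\<in>{m..<m + N}. g k (k + 1)) = (\<Sum>k=m+1..m+N. g (k - 1) k)"
proof -
  have "{m+1..m+N} = {Suc m..<Suc (m + N)}" by auto
  then show ?thesis by (simp only: sum.shift_bounds_Suc_ivl) simp
qed

context nonhomogeneous_markov_chain
begin

lemma transition_probs:
  assumes "k \<ge> 1" "i \<in> {1..b}" "j \<in> {1..b}"
  shows "0 \<le> p k i j" "p k i j \<le> 1"
  using transition_matrix_entry[OF stochastic] assms by auto

lemma integrable_state_count: "integrable M (state_count \<xi> m N i)"
  unfolding state_count_def[abs_def] by (intro Bochner_Integration.integrable_sum integrable_state)

lemma pair_count_eq:
  "pair_count \<xi> m N i j \<omega> = (\<Sum>k=m+1..m+N. indicator {i} (\<xi> (k - 1) \<omega>) * indicator {j} (\<xi> k \<omega>))"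
  unfolding pair_count_def by (rule sum_shift_step)

lemma state_count_eq:
  "state_count \<xi> m N i \<omega> = (\<Sum>k=m+1..m+N. indicator {i} (\<xi> (k - 1) \<omega>))"
  unfolding state_count_def by (rule sum_shift_step)

lemma integrable_pair_count: "integrable M (pair_count \<xi> m N i j)"
  unfolding pair_count_eq[abs_def]
  by (intro Bochner_Integration.integrable_sum
      integrable_step[of _ "\<lambda>x y. indicator {i} x * indicator {j} y"]) auto

lemma state_count_bounds: "0 \<le> state_count \<xi> m N i \<omega>" "state_count \<xi> m N i \<omega> \<le> real N"
proof -
  show "0 \<le> state_count \<xi> m N i \<omega>" unfolding state_count_def by (intro sum_nonneg) auto
  have "state_count \<xi> m N i \<omega> \<le> (\<Sum>k\<in>{m..<m + N}. 1)"
    unfolding state_count_def by (intro sum_mono) (auto simp: indicator_def)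
  then show "state_count \<xi> m N i \<omega> \<le> real N" by simp
qed

lemma pair_count_bounds: "0 \<le> pair_count \<xi> m N i j \<omega>" "pair_count \<xi> m N i j \<omega> \<le> real N"
proof -
  show "0 \<le> pair_count \<xi> m N i j \<omega>" unfolding pair_count_def by (intro sum_nonneg) auto
  have "pair_count \<xi> m N i j \<omega> \<le> (\<Sum>k\<in>{m..<m + N}. 1)"
    unfolding pair_count_def by (intro sum_mono) (auto simp: indicator_def)
  then show "pair_count \<xi> m N i j \<omega> \<le> real N" by simp
qed

lemma sum_state_indicator:
  "\<omega> \<in> space M \<Longrightarrow> (\<Sum>i=1..b. indicator {i} (\<xi> k \<omega>) * f i) = (f (\<xi> k \<omega>) :: real)"
  using state_in[of \<omega> k] by (simp add: indicator_def if_distrib[of "\<lambda>x. x * _"] cong: if_cong)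

lemma sum_state_count:
  "\<omega> \<in> space M \<Longrightarrow> (\<Sum>i=1..b. state_count \<xi> m N i \<omega>) = real N"
  unfolding state_count_def using sum_state_indicator[of \<omega> _ "\<lambda>_. 1"]
  by (subst sum.swap) simp

text \<open>Forgetting the source state leaves the visits to \<open>j\<close> in the window shifted
  by one step, which differs from the original window only at its two ends.\<close>

lemma sum_pair_count:
  assumes "\<omega> \<in> space M"
  shows "(\<Sum>i=1..b. pair_count \<xi> m N i j \<omega>) =
    state_count \<xi> m N j \<omega> + indicator {j} (\<xi> (m + N) \<omega>) - indicator {j} (\<xi> m \<omega>)"
proof -
  have "(\<Sum>i=1..b. pair_count \<xi> m N i j \<omega>) = (\<Sum>k\<in>{m..<m + N}. indicator {j} (\<xi> (k + 1) \<omega>))"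
    unfolding pair_count_def
    by (subst sum.swap)
       (intro sum.cong refl sum_state_indicator[OF assms, where f = "\<lambda>_. indicator {j} (\<xi> (k + 1) \<omega>)" for k])
  also have "\<dots> = state_count \<xi> m N j \<omega> + (\<Sum>k\<in>{m..<m + N}. indicator {j} (\<xi> (Suc k) \<omega>) - indicator {j} (\<xi> k \<omega>))"
    by (simp add: state_count_def sum_subtractf)
  also have "\<dots> = state_count \<xi> m N j \<omega> + (indicator {j} (\<xi> (m + N) \<omega>) - indicator {j} (\<xi> m \<omega>))"
    by (subst sum_Suc_diff') auto
  finally show ?thesis by simp
qed

text \<open>The difference splits into a sum of martingale differences, of order the square root of
  \<open>N\<close>, and a drift from replacing \<open>p k\<close> by \<open>P\<close>. Nothing is
  asked of \<open>P\<close> here.\<close>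

lemma pair_count_deviation:
  assumes i: "i \<in> {1..b}" and j: "j \<in> {1..b}"
  shows "expectation (\<lambda>\<omega>. \<bar>pair_count \<xi> m N i j \<omega> - state_count \<xi> m N i \<omega> * P i j\<bar>)
    \<le> sqrt (real N) + (\<Sum>k=m+1..m+N. \<bar>p k i j - P i j\<bar>)"
proof -
  define F :: "nat \<Rightarrow> nat \<Rightarrow> nat \<Rightarrow> real" where "F k x y = indicator {i} x * indicator {j} y" for k x y
  define \<Delta> where "\<Delta> = (\<Sum>k=m+1..m+N. \<bar>p k i j - P i j\<bar>)"
  have mean: "(\<Sum>y=1..b. q y * F k x y) = indicator {i} x * q j" for q k x
    using j by (simp add: F_def indicator_def if_distrib[of "\<lambda>x. _ * x"] cong: if_cong)
  \<comment> \<open>An indicator equals its square, so the conditional second moment is a transition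
    probability or zero, hence at most 1.\<close>
  have F2: "(F k x y)\<^sup>2 = F k x y" for k x y
    by (simp add: F_def indicator_def)
  have dev: "deviation F k \<omega> = F k (\<xi> (k - 1) \<omega>) (\<xi> k \<omega>) - indicator {i} (\<xi> (k - 1) \<omega>) * p k i j" for k \<omega>
    unfolding deviation_def mean by (simp add: indicator_def)
  have split: "pair_count \<xi> m N i j \<omega> - state_count \<xi> m N i \<omega> * P i j =
     (\<Sum>k=m+1..m+N. deviation F k \<omega>) + (\<Sum>k=m+1..m+N. indicator {i} (\<xi> (k - 1) \<omega>) * (p k i j - P i j))" for \<omega>
    unfolding pair_count_eq state_count_eq dev F_def
    by (simp add: sum_subtractf right_diff_distrib sum_distrib_right)
  have drift: "\<bar>\<Sum>k=m+1..m+N. indicator {i} (\<xi> (k - 1) \<omega>) * (p k i j - P i j)\<bar> \<le> \<Delta>" for \<omega>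
    unfolding \<Delta>_def by (intro order_trans[OF sum_abs] sum_mono) (auto simp: indicator_def)
  have le: "\<bar>pair_count \<xi> m N i j \<omega> - state_count \<xi> m N i \<omega> * P i j\<bar> \<le>
      \<bar>\<Sum>k=m+1..m+N. deviation F k \<omega>\<bar> + \<Delta>" for \<omega>
    using split[of \<omega>] drift[of \<omega>] by linarith
  have int: "integrable M (\<lambda>\<omega>. \<bar>\<Sum>k=m+1..m+N. deviation F k \<omega>\<bar>)"
    using integrable_deviation_sum_power[of F m N 1] by simp
  have "expectation (\<lambda>\<omega>. \<bar>pair_count \<xi> m N i j \<omega> - state_count \<xi> m N i \<omega> * P i j\<bar>) \<le>
      expectation (\<lambda>\<omega>. \<bar>\<Sum>k=m+1..m+N. deviation F k \<omega>\<bar> + \<Delta>)"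
    using le int integrable_pair_count integrable_state_count by (intro integral_mono) auto
  also have "\<dots> = expectation (\<lambda>\<omega>. \<bar>\<Sum>k=m+1..m+N. deviation F k \<omega>\<bar>) + \<Delta>"
    using int by (simp add: prob_space)
  also have "\<dots> \<le> sqrt (real N * 1) + \<Delta>"
  proof (intro add_right_mono deviation_first_moment)
    fix k x :: nat assume "k \<ge> 1" "x \<in> {1..b}"
    then show "(\<Sum>y=1..b. p k x y * (F k x y)\<^sup>2) \<le> 1"
      using transition_probs(2)[of k x j] j unfolding F2 mean by (auto simp: indicator_def)
  qed
  finally show ?thesis by (simp add: \<Delta>_def)
qed

text \<open>The counts minus \<open>N * \<pi>\<close> sum to zero, so the stability estimate bounds
  them by their defect under \<open>P\<close>. The stationary part has no defect, and that of the
  counts consists of pair deviations and end terms.\<close>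

lemma state_count_deviation:
  assumes tm: "transition_matrix b P" and \<pi>: "stationary_distribution b P \<pi>"
    and C: "0 \<le> C" "\<And>v. (\<Sum>i=1..b. v i) = 0 \<Longrightarrow>
      (\<Sum>i=1..b. \<bar>v i\<bar>) \<le> C * (\<Sum>j=1..b. \<bar>v j - (\<Sum>i=1..b. v i * P i j)\<bar>)"
  shows "expectation (\<lambda>\<omega>. \<Sum>i=1..b. \<bar>state_count \<xi> m N i \<omega> - real N * \<pi> i\<bar>)
    \<le> C * (\<Sum>j=1..b. 1 + (\<Sum>i=1..b. sqrt (real N) + (\<Sum>k=m+1..m+N. \<bar>p k i j - P i j\<bar>)))"
proof -
  let ?E = "\<lambda>i j \<omega>. \<bar>pair_count \<xi> m N i j \<omega> - state_count \<xi> m N i \<omega> * P i j\<bar>"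
  have le: "(\<Sum>i=1..b. \<bar>state_count \<xi> m N i \<omega> - real N * \<pi> i\<bar>) \<le> C * (\<Sum>j=1..b. 1 + (\<Sum>i=1..b. ?E i j \<omega>))"
    if w: "\<omega> \<in> space M" for \<omega>
  proof -
    define v where "v i = state_count \<xi> m N i \<omega> - real N * \<pi> i" for i
    have "(\<Sum>i=1..b. v i) = 0"
      using sum_state_count[OF w] \<pi>
      by (simp add: v_def sum_subtractf stationary_distribution_def flip: sum_distrib_left)
    from C(2)[OF this]
    have "(\<Sum>i=1..b. \<bar>v i\<bar>) \<le> C * (\<Sum>j=1..b. \<bar>v j - (\<Sum>i=1..b. v i * P i j)\<bar>)" .
    also have "\<dots> \<le> C * (\<Sum>j=1..b. 1 + (\<Sum>i=1..b. ?E i j \<omega>))"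
    proof (intro mult_left_mono sum_mono C(1))
      fix j assume j: "j \<in> {1..b}"
      have "(\<Sum>i=1..b. v i * P i j) = (\<Sum>i=1..b. state_count \<xi> m N i \<omega> * P i j) - real N * (\<Sum>i=1..b. \<pi> i * P i j)"
        by (simp add: v_def sum_subtractf left_diff_distrib sum_distrib_left mult.assoc)
      also have "(\<Sum>i=1..b. \<pi> i * P i j) = \<pi> j"
        using \<pi> j by (simp add: stationary_distribution_def)
      finally have "v j - (\<Sum>i=1..b. v i * P i j) = state_count \<xi> m N j \<omega> - (\<Sum>i=1..b. state_count \<xi> m N i \<omega> * P i j)"
        by (simp add: v_def)
      also have "\<dots> = (\<Sum>i=1..b. pair_count \<xi> m N i j \<omega> - state_count \<xi> m N i \<omega> * P i j)
          + (indicator {j} (\<xi> m \<omega>) - indicator {j} (\<xi> (m + N) \<omega>))"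
        using sum_pair_count[OF w, of m N j] by (simp add: sum_subtractf)
      \<comment> \<open>The two end indicators differ by at most one, which is the summand
        \<open>1\<close> in the bound.\<close>
      finally have "\<bar>v j - (\<Sum>i=1..b. v i * P i j)\<bar> \<le> \<bar>\<Sum>i=1..b. pair_count \<xi> m N i j \<omega> - state_count \<xi> m N i \<omega> * P i j\<bar> + 1"
        by (simp add: indicator_def) linarith
      also have "\<dots> \<le> (\<Sum>i=1..b. ?E i j \<omega>) + 1"
        by (intro add_right_mono sum_abs)
      finally show "\<bar>v j - (\<Sum>i=1..b. v i * P i j)\<bar> \<le> 1 + (\<Sum>i=1..b. ?E i j \<omega>)" by simp
    qed
    finally show ?thesis by (simp add: v_def)
  qed
  have int: "integrable M (?E i j)" for i j
    using integrable_pair_count integrable_state_count by auto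
  have "expectation (\<lambda>\<omega>. \<Sum>i=1..b. \<bar>state_count \<xi> m N i \<omega> - real N * \<pi> i\<bar>) \<le>
      expectation (\<lambda>\<omega>. C * (\<Sum>j=1..b. 1 + (\<Sum>i=1..b. ?E i j \<omega>)))"
    using le int integrable_state_count by (intro integral_mono) auto
  also have "\<dots> = C * (\<Sum>j=1..b. 1 + (\<Sum>i=1..b. expectation (?E i j)))"
    using int by (simp add: prob_space)
  also have "\<dots> \<le> C * (\<Sum>j=1..b. 1 + (\<Sum>i=1..b. sqrt (real N) + (\<Sum>k=m+1..m+N. \<bar>p k i j - P i j\<bar>)))"
    using C(1) by (intro mult_left_mono sum_mono add_left_mono pair_count_deviation)
  finally show ?thesis .
qed

end

section \<open>Entropy density\<close>

text \<open>Apply \<open>ln y \<le> y - 1\<close> at \<open>y = 1 / sqrt x\<close>. The square root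
  is chosen so that the square of the bound is still compensated by a factor
  \<open>x\<close>.\<close>

lemma ln_le_two_div_sqrt:
  fixes x :: real
  assumes "0 < x" "x \<le> 1"
  shows "\<bar>ln x\<bar> \<le> 2 / sqrt x"
proof -
  have "ln (1 / sqrt x) \<le> 1 / sqrt x - 1"
    using assms by (intro ln_le_minus_one) simp
  moreover have "ln (1 / sqrt x) = - ln x / 2"
    using assms by (simp add: ln_div ln_sqrt)
  moreover have "ln x \<le> 0" using assms by simp
  ultimately show ?thesis by (simp add: field_simps)
qed

lemma mult_ln_square_le:
  fixes x :: real
  assumes "0 \<le> x" "x \<le> 1"
  shows "x * (ln x)\<^sup>2 \<le> 4"
proof (cases "x = 0")
  case False
  then have x: "x > 0" using assms by simp
  have "(ln x)\<^sup>2 \<le> (2 / sqrt x)\<^sup>2"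
    using ln_le_two_div_sqrt[OF x assms(2)] power_mono[of "\<bar>ln x\<bar>" "2 / sqrt x" 2] by simp
  also have "\<dots> = 4 / x" using x by (simp add: power_divide)
  finally show ?thesis using x by (simp add: field_simps)
qed simp

lemma abs_mult_ln_le_sqrt:
  fixes x :: real
  assumes "0 \<le> x" "x \<le> 1"
  shows "\<bar>x * ln x\<bar> \<le> 2 * sqrt x"
proof (cases "x = 0")
  case False
  then have x: "x > 0" using assms by simp
  have "\<bar>x * ln x\<bar> = x * \<bar>ln x\<bar>" using x by (simp add: abs_mult)
  also have "\<dots> \<le> x * (2 / sqrt x)"
    using ln_le_two_div_sqrt[OF x assms(2)] x by (intro mult_left_mono) auto
  also have "\<dots> = 2 * sqrt x"
    using x by (simp add: field_simps)
  finally show ?thesis .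
qed simp

text \<open>Only the endpoint 0 needs care: there the function is squeezed by
  \<open>2 * sqrt y\<close>, in agreement with the convention 0 log 0 = 0.\<close>

lemma continuous_on_mult_ln: "continuous_on {0..1} (\<lambda>x::real. x * ln x)"
  unfolding continuous_on_eq_continuous_within
proof
  fix x :: real
  assume x: "x \<in> {0..1}"
  show "continuous (at x within {0..1}) (\<lambda>x. x * ln x)"
  proof (cases "x = 0")
    case True
    have "((\<lambda>y. y * ln y) \<longlongrightarrow> 0) (at 0 within {0..1::real})"
    proof (rule Lim_null_comparison)
      show "\<forall>\<^sub>F y in at 0 within {0..1}. norm (y * ln y) \<le> 2 * sqrt y"
        using abs_mult_ln_le_sqrt by (auto simp: eventually_at_filter)
      have "((\<lambda>y. 2 * sqrt y) \<longlongrightarrow> 2 * sqrt 0) (at 0 within {0..1})"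
        by (intro tendsto_intros)
      then show "((\<lambda>y. 2 * sqrt y) \<longlongrightarrow> 0) (at 0 within {0..1})" by simp
    qed
    then show ?thesis by (simp add: True continuous_within)
  next
    case False
    then show ?thesis using x by (intro continuous_intros) auto
  qed
qed

text \<open>\<open>x * ln x\<close> is not Lipschitz near 0, but a small constant plus a linear term
  suffices, and this form can be summed over \<open>k\<close> against the averaged distances of
  \<open>p k\<close> from \<open>P\<close>. Close points use uniform continuity, distant ones
  boundedness.\<close>

lemma mult_ln_modulus:
  assumes "(\<epsilon>::real) > 0"
  obtains C where "C \<ge> 0"
    and "\<And>x y. x \<in> {0..1} \<Longrightarrow> y \<in> {0..1} \<Longrightarrow> \<bar>x * ln x - y * ln y\<bar> \<le> \<epsilon> + C * \<bar>x - y :: real\<bar>"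
proof -
  have "uniformly_continuous_on {0..1} (\<lambda>x::real. x * ln x)"
    by (intro compact_uniformly_continuous continuous_on_mult_ln) simp
  then obtain d where d: "d > 0"
    and close: "\<And>x y. x \<in> {0..1} \<Longrightarrow> y \<in> {0..1} \<Longrightarrow> \<bar>x - y\<bar> < d \<Longrightarrow> \<bar>x * ln x - y * ln y\<bar> < \<epsilon>"
    unfolding uniformly_continuous_on_def dist_real_def using assms by (metis abs_minus_commute)
  have bound: "\<bar>x * ln x\<bar> \<le> 2" if "x \<in> {0..1}" for x :: real
  proof -
    have x: "0 \<le> x" "x \<le> 1" using that by auto
    then have "sqrt x \<le> 1" by simp
    then show ?thesis using abs_mult_ln_le_sqrt[OF x] by linarith
  qed
  show ?thesis
  proof (rule that[of "4 / d"])
    fix x y :: real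
    assume xy: "x \<in> {0..1}" "y \<in> {0..1}"
    show "\<bar>x * ln x - y * ln y\<bar> \<le> \<epsilon> + 4 / d * \<bar>x - y\<bar>"
    proof (cases "\<bar>x - y\<bar> < d")
      case True
      have "0 \<le> 4 / d * \<bar>x - y\<bar>" using d by simp
      then show ?thesis using close[OF xy True] by linarith
    next
      case False
      \<comment> \<open>Both values are at most 2 in modulus, so 4 dominates their
        difference.\<close>
      then have "4 \<le> 4 / d * \<bar>x - y\<bar>" using d by (simp add: field_simps)
      then show ?thesis using bound[OF xy(1)] bound[OF xy(2)] assms by linarith
    qed
  qed (use d in simp)
qed

section \<open>Moments and mean deviation of the entropy density\<close>

context nonhomogeneous_markov_chain
begin

lemma entropy_moment:
  assumes "k \<ge> 1"  "i \<in> {1..b}"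
  shows "(\<Sum>j=1..b. p k i j * (ln (p k i j))\<^sup>2) \<le> 4 * real b"
proof -
  have "(\<Sum>j=1..b. p k i j * (ln (p k i j))\<^sup>2) \<le> (\<Sum>j=1..b. 4)"
    using transition_probs assms by (intro sum_mono mult_ln_square_le)
  then show ?thesis by simp
qed

text \<open>The law at time \<open>m\<close> is not controlled, but the log of a variable's own
  probability has second moment at most 4 per state whatever the law, so the first term of the
  density is harmless after division by \<open>N\<close>.\<close>

lemma initial_entropy_moment:
  "expectation (\<lambda>\<omega>. (ln (state_distribution M \<xi> m (\<xi> m \<omega>)))\<^sup>2) \<le> 4 * real b"
proof -
  have "expectation (\<lambda>\<omega>. (ln (state_distribution M \<xi> m (\<xi> m \<omega>)))\<^sup>2) =
     (\<Sum>x=1..b. state_distribution M \<xi> m x * (ln (state_distribution M \<xi> m x))\<^sup>2)"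
    using expectation_finite_valued[OF _ state_measurable, where h = "\<lambda>x. (ln (state_distribution M \<xi> m x))\<^sup>2"]
    by (simp add: state_distribution_def)
  also have "\<dots> \<le> (\<Sum>x=1..b. 4)"
    by (intro sum_mono mult_ln_square_le) (auto simp: state_distribution_def)
  finally show ?thesis by simp
qed

lemma integrable_entropy_power:
  "integrable M (\<lambda>\<omega>. (generalized_entropy_density M \<xi> p m N \<omega>) ^ e)"
proof -
  define f where "f x = - (1 / real N) * (ln (state_distribution M \<xi> m (x m)) +
        (\<Sum>k=m+1..m+N. ln (p k (x (k - 1)) (x k))))" for x
  have "generalized_entropy_density M \<xi> p m N \<omega> = f (history (Suc (m + N)) \<omega>)" for \<omega>
  proof -
    have "(\<Sum>k=m+1..m+N. ln (p k (\<xi> (k - 1) \<omega>) (\<xi> k \<omega>))) =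
      (\<Sum>k=m+1..m+N. ln (p k (history (Suc (m + N)) \<omega> (k - 1)) (history (Suc (m + N)) \<omega> k)))"
      by (intro sum.cong refl) auto
    then show ?thesis by (simp add: f_def generalized_entropy_density_def)
  qed
  then show ?thesis using integrable_history[of "\<lambda>x. f x ^ e"] by simp
qed

text \<open>Boundedness, as used for uniform integrability, comes without centering: by
  Cauchy-Schwarz the square of the sum of logarithms has order \<open>N\<close> squared, which the
  normalization cancels.\<close>

lemma entropy_second_moment:
  assumes "N \<ge> 1"
  shows "expectation (\<lambda>\<omega>. (generalized_entropy_density M \<xi> p m N \<omega>)\<^sup>2) \<le> 16 * real b"
proof -
  define u where "u \<omega> = ln (state_distribution M \<xi> m (\<xi> m \<omega>))" for \<omega>
  define g where "g k \<omega> = ln (p k (\<xi> (k - 1) \<omega>) (\<xi> k \<omega>))" for k \<omega>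
  have u: "integrable M (\<lambda>\<omega>. (u \<omega>)\<^sup>2)" "expectation (\<lambda>\<omega>. (u \<omega>)\<^sup>2) \<le> 4 * real b"
    using integrable_state[of "\<lambda>x. (ln (state_distribution M \<xi> m x))\<^sup>2"] initial_entropy_moment
    by (auto simp: u_def)
  have g: "integrable M (\<lambda>\<omega>. (g k \<omega>)\<^sup>2)" "expectation (\<lambda>\<omega>. (g k \<omega>)\<^sup>2) \<le> 4 * real b"
    if "k \<in> {m+1..m+N}" for k
    using integrable_step[of k "\<lambda>x y. (ln (p k x y))\<^sup>2"]
      expectation_step_le[of k "\<lambda>x y. (ln (p k x y))\<^sup>2", OF _ entropy_moment] that
    by (auto simp: g_def)
  have N: "real N \<ge> 1" using assms by simp
  have le: "(generalized_entropy_density M \<xi> p m N \<omega>)\<^sup>2 \<le>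
      1 / (real N)\<^sup>2 * (2 * (u \<omega>)\<^sup>2 + 2 * (real N * (\<Sum>k=m+1..m+N. (g k \<omega>)\<^sup>2)))" for \<omega>
  proof -
    define s where "s = (\<Sum>k=m+1..m+N. g k \<omega>)"
    have "s\<^sup>2 \<le> real N * (\<Sum>k=m+1..m+N. (g k \<omega>)\<^sup>2)"
      using Cauchy_Schwarz_ineq_sum[of "\<lambda>_. 1" "\<lambda>k. g k \<omega>" "{m+1..m+N}"] by (simp add: s_def)
    moreover have "(u \<omega> + s)\<^sup>2 \<le> 2 * (u \<omega>)\<^sup>2 + 2 * s\<^sup>2"
      using zero_le_power2[of "u \<omega> - s"] by (simp add: power2_eq_square algebra_simps)
    ultimately have "(u \<omega> + s)\<^sup>2 \<le> 2 * (u \<omega>)\<^sup>2 + 2 * (real N * (\<Sum>k=m+1..m+N. (g k \<omega>)\<^sup>2))"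
      by linarith
    moreover have "(generalized_entropy_density M \<xi> p m N \<omega>)\<^sup>2 = 1 / (real N)\<^sup>2 * (u \<omega> + s)\<^sup>2"
      by (simp add: generalized_entropy_density_def u_def s_def g_def power_mult_distrib power_divide)
    ultimately show ?thesis by (simp only:) (intro mult_left_mono, auto)
  qed
  have "expectation (\<lambda>\<omega>. (generalized_entropy_density M \<xi> p m N \<omega>)\<^sup>2) \<le>
     expectation (\<lambda>\<omega>. 1 / (real N)\<^sup>2 * (2 * (u \<omega>)\<^sup>2 + 2 * (real N * (\<Sum>k=m+1..m+N. (g k \<omega>)\<^sup>2))))"
  proof (rule integral_mono[OF integrable_entropy_power _ le])
    show "integrable M (\<lambda>\<omega>. 1 / (real N)\<^sup>2 * (2 * (u \<omega>)\<^sup>2 + 2 * (real N * (\<Sum>k=m+1..m+N. (g k \<omega>)\<^sup>2))))"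
      by (intro integrable_mult_right Bochner_Integration.integrable_add Bochner_Integration.integrable_sum u g)
  qed
  also have "\<dots> = 1 / (real N)\<^sup>2 *
      (2 * expectation (\<lambda>\<omega>. (u \<omega>)\<^sup>2) + 2 * (real N * (\<Sum>k=m+1..m+N. expectation (\<lambda>\<omega>. (g k \<omega>)\<^sup>2))))"
  proof -
    have "integrable M (\<lambda>\<omega>. \<Sum>k=m+1..m+N. (g k \<omega>)\<^sup>2)"
      by (intro Bochner_Integration.integrable_sum g)
    moreover have "expectation (\<lambda>\<omega>. \<Sum>k=m+1..m+N. (g k \<omega>)\<^sup>2) = (\<Sum>k=m+1..m+N. expectation (\<lambda>\<omega>. (g k \<omega>)\<^sup>2))"
      by (intro Bochner_Integration.integral_sum g)
    ultimately show ?thesis using u(1) by simp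
  qed
  also have "\<dots> \<le> 1 / (real N)\<^sup>2 * (2 * (4 * real b) + 2 * (real N * (\<Sum>k=m+1..m+N. 4 * real b)))"
    using u(2) g(2) by (intro mult_left_mono add_mono sum_mono) auto
  also have "\<dots> \<le> 1 / (real N)\<^sup>2 * (16 * real b * (real N)\<^sup>2)"
  proof (intro mult_left_mono)
    have "real b * 1 \<le> real b * (real N)\<^sup>2"
      using N by (intro mult_left_mono one_le_power) auto
    then show "2 * (4 * real b) + 2 * (real N * (\<Sum>k=m+1..m+N. 4 * real b)) \<le> 16 * real b * (real N)\<^sup>2"
      by (simp add: power2_eq_square algebra_simps)
  qed simp
  also have "\<dots> = 16 * real b" using N by simp
  finally show ?thesis .
qed

text \<open>Beside the initial term there are three errors: centering the logarithms, replacing the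
  conditional means for \<open>p k\<close> by those for \<open>P\<close>, and replacing the state
  counts by \<open>N * \<pi>\<close>. The last is measured by the given bound
  \<open>D\<close>.\<close>

lemma entropy_deviation:
  assumes tm: "transition_matrix b P"
    and D: "expectation (\<lambda>\<omega>. \<Sum>i=1..b. \<bar>state_count \<xi> m N i \<omega> - real N * \<pi> i\<bar>) \<le> D"
  shows "expectation (\<lambda>\<omega>. \<bar>- (ln (state_distribution M \<xi> m (\<xi> m \<omega>)) +
        (\<Sum>k=m+1..m+N. ln (p k (\<xi> (k - 1) \<omega>) (\<xi> k \<omega>))))
        - real N * - (\<Sum>i=1..b. \<Sum>j=1..b. \<pi> i * P i j * ln (P i j))\<bar>)
    \<le> 1 + 4 * real b + sqrt (real N * (4 * real b))
      + (\<Sum>i=1..b. \<Sum>j=1..b. \<Sum>k=m+1..m+N. \<bar>p k i j * ln (p k i j) - P i j * ln (P i j)\<bar>)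
      + 2 * real b * D"
    (is "expectation (\<lambda>\<omega>. \<bar>?X \<omega>\<bar>) \<le> _")
proof -
  define F where "F k i j = ln (p k i j)" for k i j
  define h where "h i = (\<Sum>j=1..b. P i j * ln (P i j))" for i
  define hk where "hk k i = (\<Sum>j=1..b. p k i j * ln (p k i j))" for k i
  define \<Lambda> where "\<Lambda> = (\<Sum>i=1..b. \<Sum>j=1..b. \<Sum>k=m+1..m+N. \<bar>p k i j * ln (p k i j) - P i j * ln (P i j)\<bar>)"
  define u where "u \<omega> = ln (state_distribution M \<xi> m (\<xi> m \<omega>))" for \<omega>
  define S where "S \<omega> = (\<Sum>k=m+1..m+N. deviation F k \<omega>)" for \<omega>
  define T where "T \<omega> = (\<Sum>k=m+1..m+N. hk k (\<xi> (k - 1) \<omega>) - h (\<xi> (k - 1) \<omega>))" for \<omega>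
  define Y where "Y \<omega> = (\<Sum>i=1..b. \<bar>state_count \<xi> m N i \<omega> - real N * \<pi> i\<bar>)" for \<omega>
  have h: "\<bar>h i\<bar> \<le> 2 * real b" if i: "i \<in> {1..b}" for i
  proof -
    have "\<bar>P i j * ln (P i j)\<bar> \<le> 2" if j: "j \<in> {1..b}" for j
    proof -
      note P = transition_matrix_entry[OF tm i j]
      then have "sqrt (P i j) \<le> 1" by simp
      then show ?thesis using abs_mult_ln_le_sqrt[OF P] by linarith
    qed
    then have "(\<Sum>j=1..b. \<bar>P i j * ln (P i j)\<bar>) \<le> (\<Sum>j=1..b. 2)"
      by (rule sum_mono)
    moreover have "\<bar>h i\<bar> \<le> (\<Sum>j=1..b. \<bar>P i j * ln (P i j)\<bar>)"
      unfolding h_def by (rule sum_abs)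
    ultimately show ?thesis by simp
  qed
  have le: "\<bar>?X \<omega>\<bar> \<le> 1 + (u \<omega>)\<^sup>2 + \<bar>S \<omega>\<bar> + \<Lambda> + 2 * real b * Y \<omega>" if w: "\<omega> \<in> space M" for \<omega>
  proof -
    have "(\<Sum>k=m+1..m+N. ln (p k (\<xi> (k - 1) \<omega>) (\<xi> k \<omega>))) = S \<omega> + T \<omega> + (\<Sum>k=m+1..m+N. h (\<xi> (k - 1) \<omega>))"
      by (simp add: S_def T_def deviation_def F_def hk_def sum_subtractf)
    moreover have "(\<Sum>k=m+1..m+N. h (\<xi> (k - 1) \<omega>)) = (\<Sum>i=1..b. state_count \<xi> m N i \<omega> * h i)"
      unfolding state_count_eq sum_distrib_right
      by (subst sum.swap) (intro sum.cong refl sum_state_indicator[OF w, symmetric])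
    moreover have "real N * (\<Sum>i=1..b. \<Sum>j=1..b. \<pi> i * P i j * ln (P i j)) = (\<Sum>i=1..b. real N * \<pi> i * h i)"
      by (simp add: h_def sum_distrib_left mult.assoc)
    ultimately have X: "?X \<omega> = - (u \<omega> + S \<omega> + T \<omega> + (\<Sum>i=1..b. (state_count \<xi> m N i \<omega> - real N * \<pi> i) * h i))"
      by (simp add: u_def left_diff_distrib sum_subtractf)
    have "\<bar>\<Sum>i=1..b. (state_count \<xi> m N i \<omega> - real N * \<pi> i) * h i\<bar> \<le>
        (\<Sum>i=1..b. \<bar>state_count \<xi> m N i \<omega> - real N * \<pi> i\<bar> * (2 * real b))"
      using h by (intro order_trans[OF sum_abs] sum_mono) (auto simp: abs_mult intro!: mult_left_mono)
    also have "\<dots> = 2 * real b * Y \<omega>"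
      by (simp add: Y_def sum_distrib_left mult.commute)
    finally have Y: "\<bar>\<Sum>i=1..b. (state_count \<xi> m N i \<omega> - real N * \<pi> i) * h i\<bar> \<le> 2 * real b * Y \<omega>" .
    let ?\<delta> = "\<lambda>k i j. \<bar>p k i j * ln (p k i j) - P i j * ln (P i j)\<bar>"
    have "\<bar>T \<omega>\<bar> \<le> (\<Sum>k=m+1..m+N. \<bar>hk k (\<xi> (k - 1) \<omega>) - h (\<xi> (k - 1) \<omega>)\<bar>)"
      unfolding T_def by (rule sum_abs)
    also have "\<dots> \<le> (\<Sum>k=m+1..m+N. \<Sum>i=1..b. \<Sum>j=1..b. ?\<delta> k i j)"
    proof (rule sum_mono)
      fix k
      let ?x = "\<xi> (k - 1) \<omega>"
      have "\<bar>hk k ?x - h ?x\<bar> = \<bar>\<Sum>j=1..b. p k ?x j * ln (p k ?x j) - P ?x j * ln (P ?x j)\<bar>"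
        by (simp add: hk_def h_def sum_subtractf)
      also have "\<dots> \<le> (\<Sum>j=1..b. ?\<delta> k ?x j)"
        by (rule sum_abs)
      \<comment> \<open>Summing over all states removes the random state and makes the bound
        deterministic.\<close>
      also have "\<dots> \<le> (\<Sum>i=1..b. \<Sum>j=1..b. ?\<delta> k i j)"
        using state_in[OF w] by (intro member_le_sum sum_nonneg) auto
      finally show "\<bar>hk k ?x - h ?x\<bar> \<le> (\<Sum>i=1..b. \<Sum>j=1..b. ?\<delta> k i j)" .
    qed
    also have "\<dots> = (\<Sum>i=1..b. \<Sum>k=m+1..m+N. \<Sum>j=1..b. ?\<delta> k i j)"
      by (rule sum.swap)
    also have "\<dots> = \<Lambda>"
      unfolding \<Lambda>_def by (intro sum.cong refl sum.swap)
    finally have T: "\<bar>T \<omega>\<bar> \<le> \<Lambda>" .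
    \<comment> \<open>This turns the second moment of the initial term into a first moment bound,
      whence \<open>1 + 4 * real b\<close>.\<close>
    have "0 \<le> (\<bar>u \<omega>\<bar> - 1)\<^sup>2 + (u \<omega>)\<^sup>2 + 1" by simp
    then have u: "\<bar>u \<omega>\<bar> \<le> 1 + (u \<omega>)\<^sup>2"
      by (simp add: power2_eq_square algebra_simps)
    show ?thesis unfolding X using u T Y by linarith
  qed
  have u2: "integrable M (\<lambda>\<omega>. (u \<omega>)\<^sup>2)" "expectation (\<lambda>\<omega>. (u \<omega>)\<^sup>2) \<le> 4 * real b"
    using integrable_state[of "\<lambda>x. (ln (state_distribution M \<xi> m x))\<^sup>2"] initial_entropy_moment
    by (auto simp: u_def)
  have S: "integrable M (\<lambda>\<omega>. \<bar>S \<omega>\<bar>)" "expectation (\<lambda>\<omega>. \<bar>S \<omega>\<bar>) \<le> sqrt (real N * (4 * real b))"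
    using integrable_deviation_sum_power[of F m N 1] deviation_first_moment[of F "4 * real b" m N] entropy_moment
    by (auto simp: S_def F_def)
  have Y: "integrable M Y" "expectation Y \<le> D"
    using integrable_state_count D by (auto simp: Y_def[abs_def])
  have X: "integrable M (\<lambda>\<omega>. \<bar>?X \<omega>\<bar>)"
    using integrable_state[of "\<lambda>x. ln (state_distribution M \<xi> m x)"]
      integrable_step[of _ "\<lambda>x y. ln (p k x y)" for k]
    by (intro integrable_abs Bochner_Integration.integrable_diff integrable_minus
        Bochner_Integration.integrable_add Bochner_Integration.integrable_sum) auto
  have "expectation (\<lambda>\<omega>. \<bar>?X \<omega>\<bar>) \<le> expectation (\<lambda>\<omega>. 1 + (u \<omega>)\<^sup>2 + \<bar>S \<omega>\<bar> + \<Lambda> + 2 * real b * Y \<omega>)"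
    using le X u2 S Y by (intro integral_mono) auto
  also have "\<dots> = 1 + expectation (\<lambda>\<omega>. (u \<omega>)\<^sup>2) + expectation (\<lambda>\<omega>. \<bar>S \<omega>\<bar>) + \<Lambda> + 2 * real b * expectation Y"
    using u2 S Y by (simp add: prob_space)
  also have "\<dots> \<le> 1 + 4 * real b + sqrt (real N * (4 * real b)) + \<Lambda> + 2 * real b * D"
  proof -
    have "2 * real b * expectation Y \<le> 2 * real b * D"
      using Y(2) by (rule mult_left_mono) simp
    then show ?thesis using u2(2) S(2) by linarith
  qed
  finally show ?thesis by (simp add: \<Lambda>_def)
qed

end

section \<open>Convergence in mean\<close>

text \<open>Where \<open>\<bar>X n \<omega>\<bar>\<close> exceeds \<open>K > 0\<close> it is at most
  its square over \<open>K\<close>, so all tails are at most \<open>B / K\<close>.\<close>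

lemma (in finite_measure) uniformly_integrableI_L2:
  assumes int: "\<And>n. n \<in> I \<Longrightarrow> integrable M (X n)"
    and int2: "\<And>n. n \<in> I \<Longrightarrow> integrable M (\<lambda>\<omega>. (X n \<omega>)\<^sup>2)"
    and B: "\<And>n. n \<in> I \<Longrightarrow> (\<integral>\<omega>. (X n \<omega>)\<^sup>2 \<partial>M) \<le> B"
  shows "uniformly_integrable M I X"
  unfolding uniformly_integrable_def
proof (intro conjI ballI int)
  have tail: "(SUP n\<in>I. \<integral>\<^sup>+\<omega>. ennreal \<bar>X n \<omega>\<bar> * indicator {\<omega>. \<bar>X n \<omega>\<bar> > K} \<omega> \<partial>M) \<le> ennreal (B / K)"
    if K: "K > 0" for K :: real
  proof (rule SUP_least)
    fix n assume n: "n \<in> I"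
    have "ennreal \<bar>X n \<omega>\<bar> * indicator {\<omega>. \<bar>X n \<omega>\<bar> > K} \<omega> \<le> ennreal ((X n \<omega>)\<^sup>2 / K)" for \<omega>
    proof (cases "\<bar>X n \<omega>\<bar> > K")
      case True
      have "\<bar>X n \<omega>\<bar> * K \<le> \<bar>X n \<omega>\<bar> * \<bar>X n \<omega>\<bar>"
        using True by (intro mult_left_mono) auto
      then have "\<bar>X n \<omega>\<bar> \<le> (X n \<omega>)\<^sup>2 / K"
        using K by (simp add: field_simps power2_eq_square)
      then show ?thesis using True by (simp add: ennreal_leI)
    qed simp
    then have "(\<integral>\<^sup>+\<omega>. ennreal \<bar>X n \<omega>\<bar> * indicator {\<omega>. \<bar>X n \<omega>\<bar> > K} \<omega> \<partial>M) \<le> (\<integral>\<^sup>+\<omega>. ennreal ((X n \<omega>)\<^sup>2 / K) \<partial>M)"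
      by (intro nn_integral_mono)
    also have "\<dots> = ennreal (\<integral>\<omega>. (X n \<omega>)\<^sup>2 / K \<partial>M)"
      using K int2[OF n] by (intro nn_integral_eq_integral) auto
    also have "\<dots> \<le> ennreal (B / K)"
      using B[OF n] K by (intro ennreal_leI) (simp add: divide_right_mono)
    finally show "(\<integral>\<^sup>+\<omega>. ennreal \<bar>X n \<omega>\<bar> * indicator {\<omega>. \<bar>X n \<omega>\<bar> > K} \<omega> \<partial>M) \<le> ennreal (B / K)" .
  qed
  have "((\<lambda>K. B / K) \<longlongrightarrow> 0) at_top"
    by (intro tendsto_divide_0[OF tendsto_const] filterlim_at_top_imp_at_infinity filterlim_ident)
  then have lim: "((\<lambda>K. ennreal (B / K)) \<longlongrightarrow> 0) at_top"
    using tendsto_ennrealI by fastforce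
  show "((\<lambda>K::real. SUP n\<in>I. \<integral>\<^sup>+\<omega>. ennreal \<bar>X n \<omega>\<bar> * indicator {\<omega>. \<bar>X n \<omega>\<bar> > K} \<omega> \<partial>M) \<longlongrightarrow> 0) at_top"
    by (rule tendsto_sandwich[OF _ _ tendsto_const lim])
       (auto intro: eventually_mono[OF eventually_gt_at_top[of "0::real"]] tail)
qed

lemma (in prob_space) uniformly_integrableI_bounded:
  assumes int: "\<And>n. n \<in> I \<Longrightarrow> integrable M (X n)"
    and B: "\<And>n \<omega>. n \<in> I \<Longrightarrow> \<omega> \<in> space M \<Longrightarrow> \<bar>X n \<omega>\<bar> \<le> B"
  shows "uniformly_integrable M I X"
proof (rule uniformly_integrableI_L2[where B = "B\<^sup>2"])
  fix n assume n: "n \<in> I"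
  have sq: "(X n \<omega>)\<^sup>2 \<le> B\<^sup>2" if "\<omega> \<in> space M" for \<omega>
    using power_mono[OF B[OF n that], of 2] by simp
  show int2: "integrable M (\<lambda>\<omega>. (X n \<omega>)\<^sup>2)"
    using int[OF n] sq by (intro integrable_const_bound[where B = "B\<^sup>2"]) auto
  have "(\<integral>\<omega>. (X n \<omega>)\<^sup>2 \<partial>M) \<le> (\<integral>\<omega>. B\<^sup>2 \<partial>M)"
    using int2 sq by (intro integral_mono) auto
  then show "(\<integral>\<omega>. (X n \<omega>)\<^sup>2 \<partial>M) \<le> B\<^sup>2" by (simp add: prob_space)
qed (rule int)

text \<open>Errors are collected for unnormalized sums as little-o of \<open>r\<close>; division
  takes place only where \<open>r n\<close> is positive, thus for all large
  \<open>n\<close>.\<close>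

lemma (in finite_measure) tendsto_L1_constI:
  assumes int: "\<And>n. integrable M (X n)"
    and le: "\<And>n. (\<integral>\<omega>. \<bar>X n \<omega> - r n * c\<bar> \<partial>M) \<le> e n"
    and e: "e \<in> o(r)"
    and r: "\<And>n. r n \<ge> 0" "eventually (\<lambda>n. r n > 0) sequentially"
  shows "tendsto_L1 M (\<lambda>n \<omega>. 1 / r n * X n \<omega>) (\<lambda>_. c)"
  unfolding tendsto_L1_def
proof (intro conjI always_eventually allI)
  have "(\<lambda>n. e n / r n) \<longlonglongrightarrow> 0"
    using e by (rule smalloD_tendsto)
  moreover have "\<forall>\<^sub>F n in sequentially. norm (\<integral>\<omega>. \<bar>1 / r n * X n \<omega> - c\<bar> \<partial>M) \<le> e n / r n"
    using r(2)
  proof eventually_elim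
    case (elim n)
    have "1 / r n * X n \<omega> - c = (X n \<omega> - r n * c) / r n" for \<omega>
      using elim by (simp add: diff_divide_distrib)
    then have "(\<integral>\<omega>. \<bar>1 / r n * X n \<omega> - c\<bar> \<partial>M) = (\<integral>\<omega>. \<bar>X n \<omega> - r n * c\<bar> / r n \<partial>M)"
      using elim by (simp only: abs_divide abs_of_pos)
    also have "\<dots> \<le> e n / r n"
      using le[of n] elim by (simp add: divide_right_mono)
    finally show ?case by simp
  qed
  ultimately show "(\<lambda>n. \<integral>\<omega>. \<bar>1 / r n * X n \<omega> - c\<bar> \<partial>M) \<longlonglongrightarrow> 0"
    by (rule Lim_null_comparison[rotated])
qed (use int in auto)

lemma const_smallo_real:
  assumes "filterlim \<phi> at_top F"
  shows "(\<lambda>_. c :: real) \<in> o[F](\<lambda>n. real (\<phi> n))"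
proof (rule smalloI_tendsto)
  have "filterlim (\<lambda>n. real (\<phi> n)) at_top F"
    by (rule filterlim_compose[OF filterlim_real_sequentially assms])
  then show "((\<lambda>n. c / real (\<phi> n)) \<longlongrightarrow> 0) F"
    by (intro tendsto_divide_0[OF tendsto_const] filterlim_at_top_imp_at_infinity)
  have "eventually (\<lambda>n. 1 \<le> \<phi> n) F" using assms by (simp add: filterlim_at_top)
  then show "eventually (\<lambda>n. real (\<phi> n) \<noteq> 0) F" by eventually_elim simp
qed

lemma sqrt_smallo_real:
  assumes "filterlim \<phi> at_top F"
  shows "(\<lambda>n. sqrt (real (\<phi> n))) \<in> o[F](\<lambda>n. real (\<phi> n))"
proof (rule smalloI_tendsto)
  have "filterlim (\<lambda>n. sqrt (real (\<phi> n))) at_top F"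
    by (intro filterlim_compose[OF sqrt_at_top] filterlim_compose[OF filterlim_real_sequentially] assms)
  then have "((\<lambda>n. 1 / sqrt (real (\<phi> n))) \<longlongrightarrow> 0) F"
    by (intro tendsto_divide_0[OF tendsto_const] filterlim_at_top_imp_at_infinity)
  moreover have "sqrt (real k) / real k = 1 / sqrt (real k)" for k
    by (simp add: sqrt_divide_self_eq inverse_eq_divide)
  ultimately show "((\<lambda>n. sqrt (real (\<phi> n)) / real (\<phi> n)) \<longlongrightarrow> 0) F" by simp
  have "eventually (\<lambda>n. 1 \<le> \<phi> n) F" using assms by (simp add: filterlim_at_top)
  then show "eventually (\<lambda>n. real (\<phi> n) \<noteq> 0) F" by eventually_elim simp
qed

theorem mainTheorem2:
  fixes M :: "'w measure"
    and b :: nat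
    and \<xi> :: "nat \<Rightarrow> 'w \<Rightarrow> nat"
    and \<mu>0 :: "nat \<Rightarrow> real"
    and p :: "nat \<Rightarrow> nat \<Rightarrow> nat \<Rightarrow> real"
    and a \<phi> :: "nat \<Rightarrow> nat"
    and P :: "nat \<Rightarrow> nat \<Rightarrow> real"
    and \<pi> :: "nat \<Rightarrow> real"
  assumes chain: "nonhomogeneous_markov_chain M b \<xi> \<mu>0 p"
    and phi_lim: "filterlim \<phi> at_top sequentially"
    and phi_summable: "\<And>\<epsilon>::real. \<epsilon> > 0 \<Longrightarrow> summable (\<lambda>n. exp (- \<epsilon> * real (\<phi> (Suc n))))"
    and P_irreducible: "irreducible_transition_matrix b P"
    and p_lim: "\<And>i j. \<lbrakk>i \<in> {1..b}; j \<in> {1..b}\<rbrakk> \<Longrightarrow>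
      (\<lambda>n. 1 / real (\<phi> n) * (\<Sum>k=a n+1..a n+\<phi> n. \<bar>p k i j - P i j\<bar>)) \<longlonglongrightarrow> 0"
    and pi_stationary: "stationary_distribution b P \<pi>"
  shows "(\<forall>i\<in>{1..b}. uniformly_integrable M {n. \<phi> n \<ge> 1}
            (\<lambda>n \<omega>. 1 / real (\<phi> n) * state_count \<xi> (a n) (\<phi> n) i \<omega>)) \<and>
         (\<forall>i\<in>{1..b}. \<forall>j\<in>{1..b}. uniformly_integrable M {n. \<phi> n \<ge> 1}
            (\<lambda>n \<omega>. 1 / real (\<phi> n) * pair_count \<xi> (a n) (\<phi> n) i j \<omega>)) \<and>
         uniformly_integrable M {n. \<phi> n \<ge> 1} (\<lambda>n. generalized_entropy_density M \<xi> p (a n) (\<phi> n)) \<and>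
         (\<forall>i\<in>{1..b}. tendsto_L1 M
            (\<lambda>n \<omega>. 1 / real (\<phi> n) * state_count \<xi> (a n) (\<phi> n) i \<omega>) (\<lambda>\<omega>. \<pi> i)) \<and>
         (\<forall>i\<in>{1..b}. \<forall>j\<in>{1..b}. tendsto_L1 M
            (\<lambda>n \<omega>. 1 / real (\<phi> n) * pair_count \<xi> (a n) (\<phi> n) i j \<omega>) (\<lambda>\<omega>. \<pi> i * P i j)) \<and>
         tendsto_L1 M (\<lambda>n. generalized_entropy_density M \<xi> p (a n) (\<phi> n))
            (\<lambda>\<omega>. - (\<Sum>i=1..b. \<Sum>j=1..b. \<pi> i * P i j * ln (P i j)))"
proof -
  interpret nonhomogeneous_markov_chain M b \<xi> \<mu>0 p by (rule chain)

  \<comment> \<open>Error terms negligible against the window length\<close>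
  define r where "r n = real (\<phi> n)" for n
  define \<Delta> where "\<Delta> i j n = (\<Sum>k=a n+1..a n+\<phi> n. \<bar>p k i j - P i j\<bar>)" for i j n
  define \<Lambda> where "\<Lambda> i j n = (\<Sum>k=a n+1..a n+\<phi> n. \<bar>p k i j * ln (p k i j) - P i j * ln (P i j)\<bar>)" for i j n
  have tm: "transition_matrix b P"
    using P_irreducible by (simp add: irreducible_transition_matrix_def)
  note P = transition_matrix_entry[OF tm]
  have r_nonneg: "r n \<ge> 0" for n by (simp add: r_def)
  have r_pos: "eventually (\<lambda>n. r n > 0) sequentially"
  proof -
    have "eventually (\<lambda>n. 1 \<le> \<phi> n) sequentially"
      using phi_lim by (simp add: filterlim_at_top)
    then show ?thesis by eventually_elim (simp add: r_def)
  qed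
  have small_const: "(\<lambda>_. c) \<in> o(r)" for c :: real
    unfolding r_def[abs_def] by (rule const_smallo_real[OF phi_lim])
  have small_cmult: "(\<lambda>n. c * f n) \<in> o(r)" if "f \<in> o(r)" for c and f :: "nat \<Rightarrow> real"
    using that by simp
  have small_sqrt: "(\<lambda>n. sqrt (r n)) \<in> o(r)"
    unfolding r_def[abs_def] by (rule sqrt_smallo_real[OF phi_lim])
  have small_\<Delta>: "\<Delta> i j \<in> o(r)" if "i \<in> {1..b}" "j \<in> {1..b}" for i j
    using p_lim[OF that] r_pos
    by (intro smalloI_tendsto) (auto simp: \<Delta>_def r_def elim: eventually_mono)
  have small_\<Lambda>: "\<Lambda> i j \<in> o(r)" if i: "i \<in> {1..b}" and j: "j \<in> {1..b}" for i j
  proof (rule landau_o.smallI)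
    fix c :: real assume c: "c > 0"
    obtain C where C: "C \<ge> 0" "\<And>x y. x \<in> {0..1} \<Longrightarrow> y \<in> {0..1} \<Longrightarrow>
        \<bar>x * ln x - y * ln y\<bar> \<le> c / 2 + C * \<bar>x - y :: real\<bar>"
      using mult_ln_modulus[of "c / 2"] c by auto
    \<comment> \<open>Half of \<open>c\<close> is spent on the constant of the modulus; dividing the
      other half by \<open>C + 1\<close> instead of \<open>C\<close> also admits
      \<open>C = 0\<close>.\<close>
    have "\<forall>\<^sub>F n in sequentially. norm (\<Delta> i j n) \<le> c / (2 * (C + 1)) * norm (r n)"
      using c C(1) by (intro landau_o.smallD[OF small_\<Delta>[OF i j]]) auto
    then show "\<forall>\<^sub>F n in sequentially. norm (\<Lambda> i j n) \<le> c * norm (r n)"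
    proof eventually_elim
      case (elim n)
      have "\<Lambda> i j n \<le> (\<Sum>k=a n+1..a n+\<phi> n. c / 2 + C * \<bar>p k i j - P i j\<bar>)"
        unfolding \<Lambda>_def using P[OF i j] transition_probs i j by (intro sum_mono C(2)) auto
      also have "\<dots> = r n * (c / 2) + C * \<Delta> i j n"
        by (simp add: sum.distrib \<Delta>_def r_def sum_distrib_left)
      also have "C * \<Delta> i j n \<le> C * (c / (2 * (C + 1)) * r n)"
        using elim C(1) r_nonneg by (intro mult_left_mono) auto
      also have "\<dots> = C / (C + 1) * (r n * (c / 2))"
        using C(1) by (simp add: field_simps)
      also have "\<dots> \<le> 1 * (r n * (c / 2))"
        using C(1) c r_nonneg by (intro mult_right_mono) auto
      finally have "\<Lambda> i j n \<le> c * r n" by simp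
      moreover have "\<Lambda> i j n \<ge> 0" unfolding \<Lambda>_def by (intro sum_nonneg) auto
      ultimately show ?case using r_nonneg by simp
    qed
  qed
  obtain C where C: "0 \<le> C" "\<And>v. (\<Sum>i=1..b. v i) = 0 \<Longrightarrow>
      (\<Sum>i=1..b. \<bar>v i\<bar>) \<le> C * (\<Sum>j=1..b. \<bar>v j - (\<Sum>i=1..b. v i * P i j)\<bar>)"
    using irreducible_L1_stability[OF P_irreducible] by blast
  define D where "D n = C * (\<Sum>j=1..b. 1 + (\<Sum>i=1..b. sqrt (r n) + \<Delta> i j n))" for n
  have small_D: "D \<in> o(r)"
    unfolding D_def[abs_def] using small_const small_sqrt small_\<Delta>
    by (intro small_cmult big_sum_in_smallo sum_in_smallo) auto

  \<comment> \<open>Mean error bounds for the unnormalized quantities\<close>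
  have D: "expectation (\<lambda>\<omega>. \<Sum>i=1..b. \<bar>state_count \<xi> (a n) (\<phi> n) i \<omega> - r n * \<pi> i\<bar>) \<le> D n" for n
    using state_count_deviation[OF tm pi_stationary C, of "a n" "\<phi> n"] by (simp add: D_def r_def \<Delta>_def)
  have state: "expectation (\<lambda>\<omega>. \<bar>state_count \<xi> (a n) (\<phi> n) i \<omega> - r n * \<pi> i\<bar>) \<le> D n"
    if i: "i \<in> {1..b}" for i n
  proof -
    have "expectation (\<lambda>\<omega>. \<bar>state_count \<xi> (a n) (\<phi> n) i \<omega> - r n * \<pi> i\<bar>) \<le>
      expectation (\<lambda>\<omega>. \<Sum>i=1..b. \<bar>state_count \<xi> (a n) (\<phi> n) i \<omega> - r n * \<pi> i\<bar>)"
    proof (rule integral_mono)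
      fix \<omega>
      show "\<bar>state_count \<xi> (a n) (\<phi> n) i \<omega> - r n * \<pi> i\<bar> \<le>
          (\<Sum>i=1..b. \<bar>state_count \<xi> (a n) (\<phi> n) i \<omega> - r n * \<pi> i\<bar>)"
        using i by (intro member_le_sum) auto
    qed (use integrable_state_count in auto)
    then show ?thesis using D[of n] by linarith
  qed
  have pair: "expectation (\<lambda>\<omega>. \<bar>pair_count \<xi> (a n) (\<phi> n) i j \<omega> - r n * (\<pi> i * P i j)\<bar>)
      \<le> sqrt (r n) + \<Delta> i j n + D n" if i: "i \<in> {1..b}" and j: "j \<in> {1..b}" for i j n
  proof -
    let ?A = "\<lambda>\<omega>. \<bar>pair_count \<xi> (a n) (\<phi> n) i j \<omega> - state_count \<xi> (a n) (\<phi> n) i \<omega> * P i j\<bar>"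
    let ?B = "\<lambda>\<omega>. \<bar>state_count \<xi> (a n) (\<phi> n) i \<omega> - r n * \<pi> i\<bar>"
    have int: "integrable M ?A" "integrable M ?B"
      using integrable_pair_count integrable_state_count by auto
    have "\<bar>pair_count \<xi> (a n) (\<phi> n) i j \<omega> - r n * (\<pi> i * P i j)\<bar> \<le> ?A \<omega> + ?B \<omega>" for \<omega>
    proof -
      \<comment> \<open>The error of the state count passes to the product because the entry of
        \<open>P\<close> is at most 1.\<close>
      have "\<bar>(state_count \<xi> (a n) (\<phi> n) i \<omega> - r n * \<pi> i) * P i j\<bar> \<le> ?B \<omega>"
        using P[OF i j] by (simp add: abs_mult mult_left_le)
      then show ?thesis by (simp add: left_diff_distrib mult.assoc)
    qed
    then have "expectation (\<lambda>\<omega>. \<bar>pair_count \<xi> (a n) (\<phi> n) i j \<omega> - r n * (\<pi> i * P i j)\<bar>) \<le> expectation (\<lambda>\<omega>. ?A \<omega> + ?B \<omega>)"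
      using int integrable_pair_count by (intro integral_mono) auto
    also have "\<dots> = expectation ?A + expectation ?B" using int by simp
    also have "\<dots> \<le> sqrt (r n) + \<Delta> i j n + D n"
      using pair_count_deviation[OF i j, of "a n" "\<phi> n" P] state[OF i, of n] by (simp add: r_def \<Delta>_def)
    finally show ?thesis .
  qed
  define X where "X n \<omega> = - (ln (state_distribution M \<xi> (a n) (\<xi> (a n) \<omega>)) +
        (\<Sum>k=a n+1..a n+\<phi> n. ln (p k (\<xi> (k - 1) \<omega>) (\<xi> k \<omega>))))" for n \<omega>
  have f_eq: "generalized_entropy_density M \<xi> p (a n) (\<phi> n) \<omega> = 1 / r n * X n \<omega>" for n \<omega>
    unfolding generalized_entropy_density_def X_def r_def by (simp only: mult_minus_left mult_minus_right)
  have X_int: "integrable M (X n)" for n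
    using integrable_state[of "\<lambda>x. ln (state_distribution M \<xi> (a n) x)"]
      integrable_step[of _ "\<lambda>x y. ln (p k x y)" for k] unfolding X_def[abs_def]
    by (intro integrable_minus
        Bochner_Integration.integrable_add Bochner_Integration.integrable_sum) auto
  define E where "E n = 1 + 4 * real b + sqrt (4 * real b) * sqrt (r n)
      + (\<Sum>i=1..b. \<Sum>j=1..b. \<Lambda> i j n) + 2 * real b * D n" for n
  have small_E: "E \<in> o(r)"
    unfolding E_def[abs_def] using small_const small_sqrt small_\<Lambda> small_D
    by (intro sum_in_smallo small_cmult big_sum_in_smallo) auto
  have entropy: "expectation (\<lambda>\<omega>. \<bar>X n \<omega> - r n * - (\<Sum>i=1..b. \<Sum>j=1..b. \<pi> i * P i j * ln (P i j))\<bar>) \<le> E n" for n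
    using entropy_deviation[OF tm D[of n, unfolded r_def]]
    by (simp add: E_def X_def r_def \<Lambda>_def real_sqrt_mult mult.commute)

  \<comment> \<open>Uniform integrability and the limits\<close>
  have "uniformly_integrable M {n. \<phi> n \<ge> 1} (\<lambda>n \<omega>. 1 / real (\<phi> n) * state_count \<xi> (a n) (\<phi> n) i \<omega>)" for i
    using state_count_bounds
    by (intro uniformly_integrableI_bounded[where B = 1] integrable_mult_right integrable_state_count) auto
  moreover have "uniformly_integrable M {n. \<phi> n \<ge> 1} (\<lambda>n \<omega>. 1 / real (\<phi> n) * pair_count \<xi> (a n) (\<phi> n) i j \<omega>)" for i j
    using pair_count_bounds
    by (intro uniformly_integrableI_bounded[where B = 1] integrable_mult_right integrable_pair_count) auto
  \<comment> \<open>Unlike the normalized counts, which lie between 0 and 1, the density is not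
    uniformly bounded, so the second moment bound is used.\<close>
  moreover have "uniformly_integrable M {n. \<phi> n \<ge> 1} (\<lambda>n. generalized_entropy_density M \<xi> p (a n) (\<phi> n))"
    using integrable_entropy_power[of _ _ 1] integrable_entropy_power[of _ _ 2] entropy_second_moment
    by (intro uniformly_integrableI_L2[where B = "16 * real b"]) auto
  moreover have "tendsto_L1 M (\<lambda>n \<omega>. 1 / real (\<phi> n) * state_count \<xi> (a n) (\<phi> n) i \<omega>) (\<lambda>\<omega>. \<pi> i)"
    if "i \<in> {1..b}" for i
    unfolding r_def[symmetric]
    by (rule tendsto_L1_constI[OF integrable_state_count state[OF that] small_D r_nonneg r_pos])
  moreover have "tendsto_L1 M (\<lambda>n \<omega>. 1 / real (\<phi> n) * pair_count \<xi> (a n) (\<phi> n) i j \<omega>) (\<lambda>\<omega>. \<pi> i * P i j)"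
    if "i \<in> {1..b}" "j \<in> {1..b}" for i j
    unfolding r_def[symmetric]
    by (rule tendsto_L1_constI[OF integrable_pair_count pair[OF that] _ r_nonneg r_pos])
       (intro sum_in_smallo small_sqrt small_\<Delta>[OF that] small_D)
  moreover have "tendsto_L1 M (\<lambda>n. generalized_entropy_density M \<xi> p (a n) (\<phi> n))
            (\<lambda>\<omega>. - (\<Sum>i=1..b. \<Sum>j=1..b. \<pi> i * P i j * ln (P i j)))"
    unfolding f_eq[abs_def]
    by (rule tendsto_L1_constI[OF X_int entropy small_E r_nonneg r_pos])
  ultimately show ?thesis by blast
qed

end
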